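(* Consider a sequence of problems indexed by $k\to\infty$ (the number of categories), in which the sample sizes $n_1=n_1(k)$, $n_2=n_2(k)$ and the probability vectors ${\bf P}_c=(p_{c1},\ldots,p_{ck})$, $c=1,2$, may depend on $k$. Let ${\bf N}_1=(N_{11},\ldots,N_{1k})$ and ${\bf N}_2=(N_{21},\ldots,N_{2k})$ be independent, with ${\bf N}_c\sim \mathrm{Multinomial}(n_c,{\bf P}_c,k)$. Put $n=n_1+n_2$ and $\boldsymbol{\xi}={\bf P}_1-{\bf P}_2$. Assume: (Condition 1) $\min(n_1,n_2)\to\infty$ and $n_1/n\to c\in(0,1)$; (Condition 2) $\max_i p_{ci}^2/\|{\bf P}_c\|_2^2\to 0$ for $c=1,2$ as $k\to\infty$; (Condition 3) $n\|{\bf P}_1+{\bf P}_2\|_2^2\ge \epsilon$ for some constant $\epsilon>0$; (Condition 4) $n^2\|\boldsymbol{\xi}\|_2^4=O(\|{\bf P}_1+{\bf P}_2\|_2^2)$. Then $$\frac{\sum_{i=1}^k f^*(N_{1i},N_{2i})-\|\boldsymbol{\xi}\|_2^2}{\sigma_k}\xrightarrow{d} N(0,1),\qquad \text{where } \sigma_k^2=2\sum_{i=1}^k\left(\frac{p_{1i}}{n_1}+\frac{p_{2i}}{n_2}\right)^2 .$$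
   Context: $f^*(x_1,x_2)=\left(\frac{x_1}{n_1}-\frac{x_2}{n_2}\right)^2-\frac{x_1}{n_1^2}-\frac{x_2}{n_2^2}$. For a vector ${\bf x}=(x_1,\dots,x_k)$, $\|{\bf x}\|_2^2=\sum_i x_i^2$. $\xrightarrow{d}$ denotes convergence in distribution as $k\to\infty$. *)

theory Defs
  imports "HOL-Probability.Probability" "HOL-Library.Landau_Symbols"
begin

fun multinomial_pmf :: "nat \<Rightarrow> 'a pmf \<Rightarrow> ('a \<Rightarrow> nat) pmf" where
  "multinomial_pmf 0 p = return_pmf (\<lambda>_. 0)"
| "multinomial_pmf (Suc m) p =
     bind_pmf (multinomial_pmf m p) (\<lambda>N. map_pmf (\<lambda>x. N(x := Suc (N x))) p)"

definition fstar :: "nat \<Rightarrow> nat \<Rightarrow> nat \<Rightarrow> nat \<Rightarrow> real" where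
  "fstar n1 n2 x1 x2 =
     (real x1 / real n1 - real x2 / real n2)^2 - real x1 / (real n1)^2 - real x2 / (real n2)^2"

definition sqnorm :: "nat \<Rightarrow> (nat \<Rightarrow> real) \<Rightarrow> real" where
  "sqnorm k v = (\<Sum>i<k. (v i)^2)"

end

theory Submission
  imports Defs
begin

text \<open>
  With \<open>J\<close> the set of all \<open>n1 + n2\<close> observations, the centred observation \<open>j\<close> is the random vector
  \<open>Z j = w j (e_(X j) - q j)\<close>, where \<open>w j\<close> is \<open>1 / n1\<close> on the first sample and \<open>- 1 / n2\<close> on the second.
  The frequency difference is \<open>\<xi> + S\<close> with \<open>S = (\<Sum>j\<in>J. Z j)\<close>, and up to a linear term and a diagonal
  term, both negligible against \<open>\<sigma>\<close>, the centred statistic is the degenerate quadratic form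
  \<open>W = (\<Sum>j\<noteq>l. Z j \<bullet> Z l)\<close>.

  Asymptotic normality of \<open>W / \<sigma>\<close> follows from the Stein-Tikhomirov method: its characteristic
  function satisfies \<open>\<phi>'(t) = - t \<phi>(t) + o(1)\<close>. Write \<open>W = (\<Sum>j\<in>J. a j)\<close> with
  \<open>a j = Z j \<bullet> (S - Z j)\<close>; then \<open>W - 2 a j\<close> does not depend on observation \<open>j\<close>, and expanding
  \<open>exp (i t W)\<close> around \<open>exp (i t (W - 2 a j))\<close> leaves an error controlled by fourth moments of the
  \<open>a j\<close> and by the deviation of the sum of the conditional variances \<open>Q j\<close> of \<open>a j\<close> from its mean.
  That sum is close to \<open>\<Sum>i. \<pi> i (S i)\<^sup>2\<close> with \<open>\<pi> i = p1 i / n1 + p2 i / n2\<close>, whose variance is computed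
  by adding one observation at a time.
\<close>

section \<open>The Stein-Tikhomirov method\<close>

text \<open>A pair of observations \<open>j\<close>, \<open>l\<close> is counted both in
  \<open>a j\<close> and in \<open>a l\<close>, so observation \<open>j\<close> enters
  \<open>W\<close> through \<open>2 * a j\<close>. The first-order term of the expansion therefore
  contributes \<open>2 * s * Q j\<close>, and the normalised \<open>Q j\<close> have to sum to about
  1/2 for the coefficient of the Gaussian equation to come out as 1. This matches the scaling: the
  second moments of the \<open>a j\<close> sum to about \<open>tau\<close>, the sum of the squared
  \<pi> i, while \<sigma>^2 is \<open>2 * tau\<close>. All estimates hold for fixed sample sizes, in
  terms of a bound \<beta> on the weights, a bound \<open>m\<close> on the probabilities, a bound
  \<open>M\<close> on the \<pi> i, and \<open>tau\<close>; limits are taken only at the end.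
  Condition 1 keeps n \<beta> bounded. Condition 2 makes \<open>m\<close> vanish and forces the
  squared norms of P_1 and P_2 to 0. Condition 3 controls \<beta>^4 / \<open>tau\<close>, which has
  the order of 1 / (n^2 |P_1 + P_2|^2). Condition 4 makes the term linear in \<xi>
  negligible.\<close>

lemma cmod_iexp_le_1: "cmod (iexp y - 1) \<le> \<bar>y\<bar>"
  using iexp_approx1[of y 0] by simp

lemma cmod_iexp_le_2: "cmod (iexp y - 1 - \<i> * complex_of_real y) \<le> y\<^sup>2 / 2"
  using iexp_approx1[of y 1] by (simp add: numeral_2_eq_2 diff_diff_eq)

lemma cmod_iexp_diff: "cmod (iexp x - iexp y) \<le> \<bar>x - y\<bar>"
proof -
  have "iexp x - iexp y = iexp y * (iexp (x - y) - 1)"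
    by (simp add: right_diff_distrib flip: exp_add)
  then show ?thesis
    using cmod_iexp_le_1[of "x - y"] by (simp add: norm_mult)
qed

text \<open>
  Here \<open>W - 2 a j\<close> plays the role of the statistic without its \<open>j\<close>-th
  observation and \<open>Q j\<close> that of the conditional variance of \<open>a j\<close>; the left-hand side
  is \<open>\<phi>'(s) + s \<phi>(s)\<close> for the characteristic function \<open>\<phi>\<close> of \<open>W\<close>.
\<close>
lemma stein_tikhomirov_derivative:
  fixes M :: "'a pmf" and W :: "'a \<Rightarrow> real" and a Q :: "'j \<Rightarrow> 'a \<Rightarrow> real"
  assumes fin: "finite (set_pmf M)"
    and W: "\<And>\<omega>. \<omega> \<in> set_pmf M \<Longrightarrow> W \<omega> = (\<Sum>j\<in>J. a j \<omega>)"
    and mean: "\<And>j. j \<in> J \<Longrightarrow>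
      measure_pmf.expectation M (\<lambda>\<omega>. complex_of_real (a j \<omega>) * iexp (s * (W \<omega> - 2 * a j \<omega>))) = 0"
    and var: "\<And>j. j \<in> J \<Longrightarrow>
      measure_pmf.expectation M (\<lambda>\<omega>. complex_of_real ((a j \<omega>)\<^sup>2) * iexp (s * (W \<omega> - 2 * a j \<omega>)))
      = measure_pmf.expectation M (\<lambda>\<omega>. complex_of_real (Q j \<omega>) * iexp (s * (W \<omega> - 2 * a j \<omega>)))"
  shows "cmod (\<i> * measure_pmf.expectation M (\<lambda>\<omega>. complex_of_real (W \<omega>) * iexp (s * W \<omega>))
            + s * measure_pmf.expectation M (\<lambda>\<omega>. iexp (s * W \<omega>)))
    \<le> s\<^sup>2 * (2 * (\<Sum>j\<in>J. measure_pmf.expectation M (\<lambda>\<omega>. \<bar>a j \<omega>\<bar> ^ 3))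
            + 4 * (\<Sum>j\<in>J. measure_pmf.expectation M (\<lambda>\<omega>. \<bar>Q j \<omega>\<bar> * \<bar>a j \<omega>\<bar>)))
      + 2 * \<bar>s\<bar> * measure_pmf.expectation M (\<lambda>\<omega>. \<bar>(\<Sum>j\<in>J. Q j \<omega>) - 1 / 2\<bar>)"
    (is "cmod ?L \<le> ?R")
proof -
  have [simp]: "integrable (measure_pmf M) f" for f :: "'a \<Rightarrow> complex"
    using fin by (rule integrable_measure_pmf_finite)
  have [simp]: "integrable (measure_pmf M) f" for f :: "'a \<Rightarrow> real"
    using fin by (rule integrable_measure_pmf_finite)
  let ?E = "\<lambda>f :: 'a \<Rightarrow> complex. measure_pmf.expectation M f"
  define e where "e = (\<lambda>\<omega>. iexp (s * W \<omega>))"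
  define d where "d = (\<lambda>j \<omega>. iexp (s * (W \<omega> - 2 * a j \<omega>)))"
  \<comment> \<open>Remainder of the expansion of \<open>e\<close> to first order around
    \<open>d j\<close>; the exponents differ by \<open>2 * s * a j\<close>.\<close>
  define r where "r = (\<lambda>j \<omega>. complex_of_real (a j \<omega>) * (e \<omega> - d j \<omega> - 2 * \<i> * s * a j \<omega> * d j \<omega>))"
  have norm_E: "cmod (?E f) \<le> measure_pmf.expectation M (\<lambda>\<omega>. g \<omega>)"
    if "\<And>\<omega>. cmod (f \<omega>) \<le> g \<omega>" for f g
    by (rule order_trans[OF integral_norm_bound]) (intro integral_mono, use that in auto)
  have ea: "?E (\<lambda>\<omega>. complex_of_real (a j \<omega>) * e \<omega>)
      = ?E (r j) + 2 * \<i> * s * (?E (\<lambda>\<omega>. complex_of_real (Q j \<omega>) * e \<omega>)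
          + ?E (\<lambda>\<omega>. complex_of_real (Q j \<omega>) * (d j \<omega> - e \<omega>)))"
    if j: "j \<in> J" for j
  proof -
    have "?E (\<lambda>\<omega>. complex_of_real (a j \<omega>) * e \<omega>)
        = ?E (\<lambda>\<omega>. r j \<omega> + complex_of_real (a j \<omega>) * d j \<omega>
                + 2 * \<i> * s * (complex_of_real ((a j \<omega>)\<^sup>2) * d j \<omega>))"
      by (simp add: r_def algebra_simps power2_eq_square)
    also have "\<dots> = ?E (r j) + ?E (\<lambda>\<omega>. complex_of_real (a j \<omega>) * d j \<omega>)
                + 2 * \<i> * s * ?E (\<lambda>\<omega>. complex_of_real ((a j \<omega>)\<^sup>2) * d j \<omega>)"
      by simp
    also have "?E (\<lambda>\<omega>. complex_of_real (a j \<omega>) * d j \<omega>) = 0"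
      using mean[OF j] by (simp add: d_def)
    also have "?E (\<lambda>\<omega>. complex_of_real ((a j \<omega>)\<^sup>2) * d j \<omega>) = ?E (\<lambda>\<omega>. complex_of_real (Q j \<omega>) * d j \<omega>)"
      using var[OF j] by (simp add: d_def)
    \<comment> \<open>Only with the common factor \<open>e\<close> can the \<open>Q j\<close> be
      summed over \<open>j\<close> and compared with 1/2, so \<open>d j\<close> is traded for
      \<open>e\<close> at the cost of one more error term.\<close>
    also have "\<dots> = ?E (\<lambda>\<omega>. complex_of_real (Q j \<omega>) * e \<omega> + complex_of_real (Q j \<omega>) * (d j \<omega> - e \<omega>))"
      by (simp add: algebra_simps)
    also have "\<dots> = ?E (\<lambda>\<omega>. complex_of_real (Q j \<omega>) * e \<omega>)
        + ?E (\<lambda>\<omega>. complex_of_real (Q j \<omega>) * (d j \<omega> - e \<omega>))"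
      by (rule Bochner_Integration.integral_add) simp_all
    finally show ?thesis by simp
  qed
  have "?E (\<lambda>\<omega>. complex_of_real (W \<omega>) * e \<omega>) = ?E (\<lambda>\<omega>. \<Sum>j\<in>J. complex_of_real (a j \<omega>) * e \<omega>)"
    by (intro integral_cong_AE) (auto simp: AE_measure_pmf_iff W sum_distrib_right)
  also have "\<dots> = (\<Sum>j\<in>J. ?E (\<lambda>\<omega>. complex_of_real (a j \<omega>) * e \<omega>))"
    by (simp del: integral_mult_right_zero)
  also have "\<dots> = (\<Sum>j\<in>J. ?E (r j)) + 2 * \<i> * s * ((\<Sum>j\<in>J. ?E (\<lambda>\<omega>. complex_of_real (Q j \<omega>) * e \<omega>))
          + (\<Sum>j\<in>J. ?E (\<lambda>\<omega>. complex_of_real (Q j \<omega>) * (d j \<omega> - e \<omega>))))"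
    by (simp add: ea sum.distrib flip: sum_distrib_left)
  finally have EW: "?E (\<lambda>\<omega>. complex_of_real (W \<omega>) * e \<omega>) = \<dots>" .
  have "?E (\<lambda>\<omega>. complex_of_real ((\<Sum>j\<in>J. Q j \<omega>) - 1 / 2) * e \<omega>)
      = ?E (\<lambda>\<omega>. (\<Sum>j\<in>J. complex_of_real (Q j \<omega>) * e \<omega>) - e \<omega> / 2)"
    by (simp add: algebra_simps sum_distrib_left)
  also have "\<dots> = (\<Sum>j\<in>J. ?E (\<lambda>\<omega>. complex_of_real (Q j \<omega>) * e \<omega>)) - ?E e / 2"
    by simp
  finally have Q: "?E (\<lambda>\<omega>. complex_of_real ((\<Sum>j\<in>J. Q j \<omega>) - 1 / 2) * e \<omega>) = \<dots>" .
  \<comment> \<open>The factor \<open>\<i>\<close> turns \<open>2 * \<i> * s\<close> into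
    \<open>- 2 * s\<close>, so the sum of the \<open>Q j * e\<close> cancels \<open>s * E e\<close>
    up to the deviation of the sum of the \<open>Q j\<close> from 1/2.\<close>
  have L: "?L = \<i> * (\<Sum>j\<in>J. ?E (r j)) - 2 * s * (\<Sum>j\<in>J. ?E (\<lambda>\<omega>. complex_of_real (Q j \<omega>) * (d j \<omega> - e \<omega>)))
      - 2 * s * ?E (\<lambda>\<omega>. complex_of_real ((\<Sum>j\<in>J. Q j \<omega>) - 1 / 2) * e \<omega>)"
    unfolding Q using EW by (simp add: e_def algebra_simps)
  have b1: "cmod (?E (r j)) \<le> 2 * s\<^sup>2 * measure_pmf.expectation M (\<lambda>\<omega>. \<bar>a j \<omega>\<bar> ^ 3)" for j
  proof -
    have "cmod (r j \<omega>) \<le> 2 * s\<^sup>2 * \<bar>a j \<omega>\<bar> ^ 3" for \<omega>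
    proof -
      have "r j \<omega> = complex_of_real (a j \<omega>) * (d j \<omega> *
          (iexp (2 * s * a j \<omega>) - 1 - \<i> * complex_of_real (2 * s * a j \<omega>)))"
        unfolding r_def e_def d_def
        by (simp add: algebra_simps flip: exp_add)
      then have "cmod (r j \<omega>) = \<bar>a j \<omega>\<bar> * cmod (iexp (2 * s * a j \<omega>) - 1 - \<i> * complex_of_real (2 * s * a j \<omega>))"
        by (simp add: norm_mult d_def)
      also have "\<dots> \<le> \<bar>a j \<omega>\<bar> * ((2 * s * a j \<omega>)\<^sup>2 / 2)"
        by (intro mult_left_mono cmod_iexp_le_2) auto
      also have "\<dots> = 2 * s\<^sup>2 * \<bar>a j \<omega>\<bar> ^ 3"
        by (simp add: power_mult_distrib power3_eq_cube power2_eq_square)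
      finally show ?thesis .
    qed
    from norm_E[OF this] show ?thesis by simp
  qed
  have b2: "cmod (?E (\<lambda>\<omega>. complex_of_real (Q j \<omega>) * (d j \<omega> - e \<omega>)))
      \<le> 2 * \<bar>s\<bar> * measure_pmf.expectation M (\<lambda>\<omega>. \<bar>Q j \<omega>\<bar> * \<bar>a j \<omega>\<bar>)" for j
  proof -
    have "cmod (complex_of_real (Q j \<omega>) * (d j \<omega> - e \<omega>)) \<le> 2 * \<bar>s\<bar> * (\<bar>Q j \<omega>\<bar> * \<bar>a j \<omega>\<bar>)" for \<omega>
    proof -
      have "cmod (d j \<omega> - e \<omega>) \<le> \<bar>s * (W \<omega> - 2 * a j \<omega>) - s * W \<omega>\<bar>"
        unfolding d_def e_def by (rule cmod_iexp_diff)
      also have "\<dots> = 2 * \<bar>s\<bar> * \<bar>a j \<omega>\<bar>"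
        by (simp add: algebra_simps abs_mult)
      finally have "\<bar>Q j \<omega>\<bar> * cmod (d j \<omega> - e \<omega>) \<le> \<bar>Q j \<omega>\<bar> * (2 * \<bar>s\<bar> * \<bar>a j \<omega>\<bar>)"
        by (rule mult_left_mono) simp
      then show ?thesis by (simp add: norm_mult mult_ac)
    qed
    from norm_E[OF this] show ?thesis by simp
  qed
  have b3: "cmod (?E (\<lambda>\<omega>. complex_of_real ((\<Sum>j\<in>J. Q j \<omega>) - 1 / 2) * e \<omega>))
      \<le> measure_pmf.expectation M (\<lambda>\<omega>. \<bar>(\<Sum>j\<in>J. Q j \<omega>) - 1 / 2\<bar>)"
    by (intro norm_E) (simp add: norm_mult e_def del: of_real_diff of_real_sum)
  have "cmod ?L \<le> cmod (\<Sum>j\<in>J. ?E (r j))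
      + 2 * \<bar>s\<bar> * cmod (\<Sum>j\<in>J. ?E (\<lambda>\<omega>. complex_of_real (Q j \<omega>) * (d j \<omega> - e \<omega>)))
      + 2 * \<bar>s\<bar> * cmod (?E (\<lambda>\<omega>. complex_of_real ((\<Sum>j\<in>J. Q j \<omega>) - 1 / 2) * e \<omega>))"
  proof -
    have tri: "cmod (\<i> * x - complex_of_real (2 * s) * y - complex_of_real (2 * s) * z)
        \<le> cmod x + 2 * \<bar>s\<bar> * cmod y + 2 * \<bar>s\<bar> * cmod z" for x y z
      using norm_triangle_ineq4[of "\<i> * x - complex_of_real (2 * s) * y" "complex_of_real (2 * s) * z"]
        norm_triangle_ineq4[of "\<i> * x" "complex_of_real (2 * s) * y"]
      by (simp add: norm_mult)
    show ?thesis unfolding L by (rule tri)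
  qed
  also have "\<dots> \<le> (\<Sum>j\<in>J. 2 * s\<^sup>2 * measure_pmf.expectation M (\<lambda>\<omega>. \<bar>a j \<omega>\<bar> ^ 3))
      + 2 * \<bar>s\<bar> * (\<Sum>j\<in>J. 2 * \<bar>s\<bar> * measure_pmf.expectation M (\<lambda>\<omega>. \<bar>Q j \<omega>\<bar> * \<bar>a j \<omega>\<bar>))
      + 2 * \<bar>s\<bar> * measure_pmf.expectation M (\<lambda>\<omega>. \<bar>(\<Sum>j\<in>J. Q j \<omega>) - 1 / 2\<bar>)"
    by (intro add_mono mult_left_mono sum_norm_le b1 b2 b3) auto
  also have "\<dots> = ?R"
  proof -
    have "2 * \<bar>s\<bar> * (2 * \<bar>s\<bar> * x) = s\<^sup>2 * (4 * x)" for x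
      using abs_mult_self_eq[of s] by (simp add: power2_eq_square)
    then show ?thesis
      unfolding sum_distrib_left[symmetric] by (simp add: distrib_left)
  qed
  finally show ?thesis .
qed

text \<open>Integrates the differential inequality: \<open>exp (z^2 / 2)\<close> is the integrating
  factor of \<open>\<phi>' + z * \<phi>\<close>, so the mean value inequality between 0 and
  \<open>t\<close> bounds \<open>exp (t^2 / 2) * \<phi> t - 1\<close>. On the segment the
  integrating factor is at most its value at \<open>t\<close>, hence it cancels from the final
  bound.\<close>

theorem stein_tikhomirov:
  fixes M :: "'a pmf" and W :: "'a \<Rightarrow> real" and a Q :: "'j \<Rightarrow> 'a \<Rightarrow> real"
  assumes fin: "finite (set_pmf M)"
    and W: "\<And>\<omega>. \<omega> \<in> set_pmf M \<Longrightarrow> W \<omega> = (\<Sum>j\<in>J. a j \<omega>)"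
    and mean: "\<And>j s. j \<in> J \<Longrightarrow>
      measure_pmf.expectation M (\<lambda>\<omega>. complex_of_real (a j \<omega>) * iexp (s * (W \<omega> - 2 * a j \<omega>))) = 0"
    and var: "\<And>j s. j \<in> J \<Longrightarrow>
      measure_pmf.expectation M (\<lambda>\<omega>. complex_of_real ((a j \<omega>)\<^sup>2) * iexp (s * (W \<omega> - 2 * a j \<omega>)))
      = measure_pmf.expectation M (\<lambda>\<omega>. complex_of_real (Q j \<omega>) * iexp (s * (W \<omega> - 2 * a j \<omega>)))"
  shows "cmod (measure_pmf.expectation M (\<lambda>\<omega>. iexp (t * W \<omega>)) - complex_of_real (exp (- (t\<^sup>2) / 2)))
    \<le> \<bar>t\<bar> * (t\<^sup>2 * (2 * (\<Sum>j\<in>J. measure_pmf.expectation M (\<lambda>\<omega>. \<bar>a j \<omega>\<bar> ^ 3))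
            + 4 * (\<Sum>j\<in>J. measure_pmf.expectation M (\<lambda>\<omega>. \<bar>Q j \<omega>\<bar> * \<bar>a j \<omega>\<bar>)))
      + 2 * \<bar>t\<bar> * measure_pmf.expectation M (\<lambda>\<omega>. \<bar>(\<Sum>j\<in>J. Q j \<omega>) - 1 / 2\<bar>))"
proof -
  let ?S = "set_pmf M"
  define X where "X = 2 * (\<Sum>j\<in>J. measure_pmf.expectation M (\<lambda>\<omega>. \<bar>a j \<omega>\<bar> ^ 3))
            + 4 * (\<Sum>j\<in>J. measure_pmf.expectation M (\<lambda>\<omega>. \<bar>Q j \<omega>\<bar> * \<bar>a j \<omega>\<bar>))"
  define Y where "Y = measure_pmf.expectation M (\<lambda>\<omega>. \<bar>(\<Sum>j\<in>J. Q j \<omega>) - 1 / 2\<bar>)"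
  have X0: "0 \<le> X" unfolding X_def
    by (intro add_nonneg_nonneg mult_nonneg_nonneg sum_nonneg integral_nonneg_AE) auto
  have Y0: "0 \<le> Y" unfolding Y_def by (intro integral_nonneg_AE) auto
  have sumE: "measure_pmf.expectation M f = (\<Sum>\<omega>\<in>?S. pmf M \<omega> * f \<omega>)" for f :: "'a \<Rightarrow> complex"
    by (subst integral_measure_pmf[OF fin]) (auto simp: scaleR_conv_of_real)
  \<comment> \<open>The support is finite, so the characteristic function extends to an entire
    function of \<open>z\<close>. Complex differentiation is then available, and the mean value
    inequality is applied on the embedded real segment.\<close>
  define \<phi> where "\<phi> = (\<lambda>z. \<Sum>\<omega>\<in>?S. pmf M \<omega> * exp (\<i> * z * complex_of_real (W \<omega>)))"
  define \<phi>' where "\<phi>' = (\<lambda>z. \<Sum>\<omega>\<in>?S. pmf M \<omega> * (\<i> * complex_of_real (W \<omega>) * exp (\<i> * z * complex_of_real (W \<omega>))))"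
  define g where "g = (\<lambda>z. exp (z\<^sup>2 / 2) * \<phi> z)"
  define g' where "g' = (\<lambda>z. exp (z\<^sup>2 / 2) * (\<phi>' z + z * \<phi> z))"
  have \<phi>: "(\<phi> has_field_derivative \<phi>' z) (at z)" for z
    unfolding \<phi>_def \<phi>'_def
    by (auto intro!: derivative_eq_intros sum.cong simp: algebra_simps)
  have g: "(g has_field_derivative g' z) (at z)" for z
    unfolding g_def g'_def
    by (auto intro!: derivative_eq_intros \<phi> simp: algebra_simps)
  have \<phi>E: "measure_pmf.expectation M (\<lambda>\<omega>. iexp (s * W \<omega>)) = \<phi> (complex_of_real s)" for s
    by (simp add: sumE \<phi>_def mult.assoc)
  have \<phi>'E: "\<i> * measure_pmf.expectation M (\<lambda>\<omega>. complex_of_real (W \<omega>) * iexp (s * W \<omega>))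
      = \<phi>' (complex_of_real s)" for s
    by (simp add: sumE \<phi>'_def sum_distrib_left mult_ac)
  have "cmod (g (complex_of_real t) - g 0)
      \<le> (exp (t\<^sup>2 / 2) * (t\<^sup>2 * X + 2 * \<bar>t\<bar> * Y)) * cmod (complex_of_real t - 0)"
  proof (rule field_differentiable_bound[of "complex_of_real ` {- \<bar>t\<bar>..\<bar>t\<bar>}"])
    show "convex (complex_of_real ` {- \<bar>t\<bar>..\<bar>t\<bar>})"
      by (intro convex_linear_image convex_closed_interval convex_real_interval) 
         (simp add: linear_of_real)
  next
    fix z assume "z \<in> complex_of_real ` {- \<bar>t\<bar>..\<bar>t\<bar>}"
    then obtain s where z: "z = complex_of_real s" and s: "\<bar>s\<bar> \<le> \<bar>t\<bar>" by auto
    show "(g has_field_derivative g' z) (at z within complex_of_real ` {- \<bar>t\<bar>..\<bar>t\<bar>})"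
      by (rule has_field_derivative_at_within[OF g])
    have s2: "s\<^sup>2 \<le> t\<^sup>2" using s by (simp add: abs_le_square_iff)
    have "cmod (\<phi>' z + z * \<phi> z) \<le> s\<^sup>2 * X + 2 * \<bar>s\<bar> * Y"
      using stein_tikhomirov_derivative[where s = s and J = J and Q = Q, OF fin W mean var]
      unfolding \<phi>E \<phi>'E X_def Y_def z by simp
    also have "\<dots> \<le> t\<^sup>2 * X + 2 * \<bar>t\<bar> * Y"
      using X0 Y0 s s2 by (intro add_mono mult_right_mono) auto
    finally have 1: "cmod (\<phi>' z + z * \<phi> z) \<le> t\<^sup>2 * X + 2 * \<bar>t\<bar> * Y" .
    have 2: "cmod (exp (z\<^sup>2 / 2)) \<le> exp (t\<^sup>2 / 2)"
      using s2 by (simp add: z flip: of_real_power)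
    show "cmod (g' z) \<le> exp (t\<^sup>2 / 2) * (t\<^sup>2 * X + 2 * \<bar>t\<bar> * Y)"
      unfolding g'_def norm_mult by (intro mult_mono 1 2) auto
  next
    show "complex_of_real t \<in> complex_of_real ` {- \<bar>t\<bar>..\<bar>t\<bar>}" by (intro imageI) auto
    show "0 \<in> complex_of_real ` {- \<bar>t\<bar>..\<bar>t\<bar>}" by (auto intro!: image_eqI[of _ _ 0])
  qed
  also have "g 0 = 1"
    using sum_pmf_eq_1[OF fin subset_refl] by (simp add: g_def \<phi>_def flip: of_real_sum)
  finally have "cmod (g (complex_of_real t) - 1) \<le> exp (t\<^sup>2 / 2) * (\<bar>t\<bar> * (t\<^sup>2 * X + 2 * \<bar>t\<bar> * Y))"
    by (simp add: mult_ac)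
  also have "g (complex_of_real t) - 1
      = exp (complex_of_real (t\<^sup>2 / 2)) * (\<phi> (complex_of_real t) - complex_of_real (exp (- (t\<^sup>2) / 2)))"
    by (simp add: g_def right_diff_distrib flip: exp_add exp_of_real)
  finally show ?thesis
    unfolding \<phi>E X_def Y_def by (simp add: norm_mult)
qed

section \<open>Sums of independent centred multinomial vectors\<close>

lemma expectation_finite_mono:
  fixes f g :: "'a \<Rightarrow> real"
  assumes "finite (set_pmf M)" "\<And>x. x \<in> set_pmf M \<Longrightarrow> f x \<le> g x"
  shows "measure_pmf.expectation M f \<le> measure_pmf.expectation M g"
  using assms by (intro integral_mono_AE) (auto simp: AE_measure_pmf_iff integrable_measure_pmf_finite)

lemma expectation_abs_le_sqrt:
  fixes f :: "'a \<Rightarrow> real"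
  assumes fin: "finite (set_pmf M)"
  shows "measure_pmf.expectation M (\<lambda>x. \<bar>f x\<bar>) \<le> sqrt (measure_pmf.expectation M (\<lambda>x. (f x)\<^sup>2))"
proof -
  have [simp]: "integrable (measure_pmf M) g" for g :: "'a \<Rightarrow> real"
    using fin by (rule integrable_measure_pmf_finite)
  define m where "m = measure_pmf.expectation M (\<lambda>x. \<bar>f x\<bar>)"
  have "0 \<le> measure_pmf.expectation M (\<lambda>x. (\<bar>f x\<bar> - m)\<^sup>2)"
    by (intro integral_nonneg_AE) auto
  also have "(\<lambda>x. (\<bar>f x\<bar> - m)\<^sup>2) = (\<lambda>x. (f x)\<^sup>2 - 2 * m * \<bar>f x\<bar> + m\<^sup>2)"
    by (simp add: fun_eq_iff power2_diff)
  also have "measure_pmf.expectation M \<dots> = measure_pmf.expectation M (\<lambda>x. (f x)\<^sup>2) - 2 * m * m + m\<^sup>2"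
    by (simp add: m_def)
  finally show ?thesis
    unfolding m_def[symmetric] by (intro real_le_rsqrt) (simp add: power2_eq_square)
qed

text \<open>Both samples form one family of independent observations, the sign of \<open>w j\<close>
  recording the sample. A finite \<open>K\<close> carrying all supports makes every expectation a
  finite sum.\<close>

locale product_sample =
  fixes J :: "'j set" and q :: "'j \<Rightarrow> 'x pmf" and w :: "'j \<Rightarrow> real" and K :: "'x set"
  assumes finite_J [simp]: "finite J"
    and finite_K [simp]: "finite K"
    and supp: "\<And>j. j \<in> J \<Longrightarrow> set_pmf (q j) \<subseteq> K"
begin

definition P :: "('j \<Rightarrow> 'x) pmf" where
  "P = Pi_pmf J undefined q"

abbreviation E :: "(('j \<Rightarrow> 'x) \<Rightarrow> 'b::{banach, second_countable_topology}) \<Rightarrow> 'b" where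
  "E f \<equiv> measure_pmf.expectation P f"

text \<open>
  \<open>resample j\<close> is the conditional expectation given all coordinates but the \<open>j\<close>-th. All uses
  of independence go through it.
\<close>
definition resample ::
    "'j \<Rightarrow> (('j \<Rightarrow> 'x) \<Rightarrow> 'b::{banach, second_countable_topology}) \<Rightarrow> ('j \<Rightarrow> 'x) \<Rightarrow> 'b" where
  "resample j f X = measure_pmf.expectation (q j) (\<lambda>x. f (X(j := x)))"

abbreviation pr :: "'j \<Rightarrow> 'x \<Rightarrow> real" where
  "pr j \<equiv> pmf (q j)"

lemma finite_q: "j \<in> J \<Longrightarrow> finite (set_pmf (q j))"
  by (rule finite_subset[OF supp finite_K])

lemma finite_P [simp]: "finite (set_pmf P)"
  unfolding P_def by (subst set_Pi_pmf) (auto simp: finite_q)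

lemma P_in_K: "X \<in> set_pmf P \<Longrightarrow> j \<in> J \<Longrightarrow> X j \<in> K"
  unfolding P_def using supp by (auto simp: set_Pi_pmf PiE_dflt_def)

lemma integrable_P [simp]:
  "integrable (measure_pmf P) (f :: _ \<Rightarrow> 'b::{banach, second_countable_topology})"
  by (intro integrable_measure_pmf_finite finite_P)

lemma sum_pr: "j \<in> J \<Longrightarrow> (\<Sum>x\<in>K. pr j x) = 1"
  using supp by (intro sum_pmf_eq_1) auto

lemma E_mono: "(\<And>X. X \<in> set_pmf P \<Longrightarrow> f X \<le> g X) \<Longrightarrow> E f \<le> E g" for f g :: "_ \<Rightarrow> real"
  by (intro expectation_finite_mono) auto

lemma E_cong: "(\<And>X. X \<in> set_pmf P \<Longrightarrow> f X = g X) \<Longrightarrow> E f = E g"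
  by (intro integral_cong_AE) (auto simp: AE_measure_pmf_iff)

lemma E_nonneg: "(\<And>X. 0 \<le> f X) \<Longrightarrow> 0 \<le> E f" for f :: "_ \<Rightarrow> real"
  by (intro integral_nonneg_AE) auto

lemma E_const [simp]: "E (\<lambda>_. c) = c"
  by simp

text \<open>\<open>P\<close> is the law \<open>R\<close> of the other coordinates followed by a draw
  of coordinate \<open>j\<close>, so an expectation under \<open>P\<close> is an
  \<open>R\<close>-average of \<open>resample j\<close>. As \<open>resample j\<close> is idempotent,
  \<open>f\<close> and \<open>resample j f\<close> have the same average.\<close>

lemma E_resample:
  fixes f :: "('j \<Rightarrow> 'x) \<Rightarrow> 'b::{banach, second_countable_topology}"
  assumes j: "j \<in> J"
  shows "E (resample j f) = E f"
proof -
  define R where "R = Pi_pmf (J - {j}) undefined q"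
  have finR: "finite (set_pmf R)"
    unfolding R_def by (subst set_Pi_pmf) (auto simp: finite_q)
  have P: "P = bind_pmf R (\<lambda>g. map_pmf (\<lambda>y. g(j := y)) (q j))"
  proof -
    have "P = Pi_pmf (insert j (J - {j})) undefined q"
      using j by (simp add: P_def insert_absorb)
    also have "\<dots> = bind_pmf (q j) (\<lambda>y. bind_pmf R (\<lambda>g. return_pmf (g(j := y))))"
      unfolding R_def by (subst Pi_pmf_insert') simp_all
    also have "\<dots> = bind_pmf R (\<lambda>g. bind_pmf (q j) (\<lambda>y. return_pmf (g(j := y))))"
      by (rule bind_commute_pmf)
    finally show ?thesis by (simp add: map_pmf_def)
  qed
  have *: "E h = (\<Sum>g\<in>set_pmf R. pmf R g *\<^sub>R resample j h g)" for h :: "('j \<Rightarrow> 'x) \<Rightarrow> 'b"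
    unfolding P using finite_q[OF j] finR
    by (subst pmf_expectation_bind[of "set_pmf R"]) (auto simp: resample_def)
  have "resample j (resample j f) = resample j f"
    by (simp add: resample_def fun_eq_iff)
  then show ?thesis by (simp add: *)
qed

lemma E_mult_indep:
  fixes f g :: "('j \<Rightarrow> 'x) \<Rightarrow> 'b::{banach, second_countable_topology, real_normed_field}"
  assumes j: "j \<in> J" and g: "\<And>X x. g (X(j := x)) = g X"
  shows "E (\<lambda>X. f X * g X) = E (\<lambda>X. resample j f X * g X)"
proof -
  have "E (\<lambda>X. f X * g X) = E (resample j (\<lambda>X. f X * g X))"
    by (rule E_resample[OF j, symmetric])
  also have "resample j (\<lambda>X. f X * g X) = (\<lambda>X. resample j f X * g X)"
    by (intro ext) (simp add: resample_def g)
  finally show ?thesis .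
qed

lemma resample_eq_sum:
  fixes f :: "('j \<Rightarrow> 'x) \<Rightarrow> real"
  assumes "j \<in> J"
  shows "resample j f X = (\<Sum>x\<in>K. pr j x * f (X(j := x)))"
  unfolding resample_def using supp[OF assms]
  by (subst integral_measure_pmf_real[of K]) (auto simp: mult.commute)

section \<open>Centred observations and linear forms in them\<close>

definition Z :: "'j \<Rightarrow> 'x \<Rightarrow> ('j \<Rightarrow> 'x) \<Rightarrow> real" where
  "Z j x X = w j * (of_bool (X j = x) - pr j x)"

definition S :: "'j set \<Rightarrow> 'x \<Rightarrow> ('j \<Rightarrow> 'x) \<Rightarrow> real" where
  "S A x X = (\<Sum>j\<in>A. Z j x X)"

text \<open>Inner product of the vector \<open>Z j\<close> with \<open>u\<close>; in the
  applications \<open>u\<close> may be random but is free of observation \<open>j\<close>.\<close>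

definition lin :: "'j \<Rightarrow> ('x \<Rightarrow> real) \<Rightarrow> ('j \<Rightarrow> 'x) \<Rightarrow> real" where
  "lin j u X = (\<Sum>x\<in>K. Z j x X * u x)"

lemma Z_upd_other [simp]: "l \<noteq> j \<Longrightarrow> Z l x (X(j := v)) = Z l x X"
  by (simp add: Z_def)

lemma S_upd_other [simp]: "j \<notin> A \<Longrightarrow> S A x (X(j := v)) = S A x X"
  unfolding S_def by (intro sum.cong) (auto intro!: Z_upd_other)

lemma S_empty [simp]: "S {} x X = 0"
  by (simp add: S_def)

lemma S_insert: "finite A \<Longrightarrow> j \<notin> A \<Longrightarrow> S (insert j A) x X = Z j x X + S A x X"
  by (simp add: S_def)

lemma lin_upd_other [simp]: "l \<noteq> j \<Longrightarrow> lin l u (X(j := v)) = lin l u X"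
  by (simp add: lin_def)

lemma lin_eq: "X j \<in> K \<Longrightarrow> lin j u X = w j * (u (X j) - (\<Sum>x\<in>K. pr j x * u x))"
proof -
  assume "X j \<in> K"
  have "lin j u X = (\<Sum>x\<in>K. w j * (of_bool (X j = x) * u x - pr j x * u x))"
    by (simp add: lin_def Z_def algebra_simps)
  also have "\<dots> = w j * ((\<Sum>x\<in>K. of_bool (X j = x) * u x) - (\<Sum>x\<in>K. pr j x * u x))"
    by (simp add: sum_subtractf flip: sum_distrib_left)
  also have "(\<Sum>x\<in>K. of_bool (X j = x) * u x) = u (X j)"
    using \<open>X j \<in> K\<close> by (simp add: of_bool_def if_distrib[of "\<lambda>z. z * _"] cong: if_cong)
  finally show ?thesis .
qed

lemma lin_of_bool: "x \<in> K \<Longrightarrow> lin j (\<lambda>y. of_bool (y = x)) X = Z j x X"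
  by (simp add: lin_def of_bool_def if_distrib[of "\<lambda>z. _ * z"] cong: if_cong)

definition mean :: "'j \<Rightarrow> ('x \<Rightarrow> real) \<Rightarrow> real" where
  "mean j u = (\<Sum>x\<in>K. pr j x * u x)"

text \<open>By \<open>lin_eq\<close> the form is \<open>w j\<close> times the centred value of
  \<open>u\<close> at observation \<open>j\<close>. Since \<open>u\<close> does not see that
  observation, conditional moments are central moments under \<open>q j\<close>.\<close>

lemma resample_lin_power:
  assumes j: "j \<in> J" and u: "\<And>v. u (X(j := v)) = u X"
  shows "resample j (\<lambda>X. lin j (u X) X ^ n) X = w j ^ n * mean j (\<lambda>x. (u X x - mean j (u X)) ^ n)"
  by (simp add: resample_eq_sum[OF j] lin_eq u mean_def power_mult_distrib sum_distrib_left mult_ac)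

lemma mean_add: "mean j (\<lambda>x. u x + v x) = mean j u + mean j v"
  by (simp add: mean_def algebra_simps sum.distrib)

lemma mean_diff: "mean j (\<lambda>x. u x - v x) = mean j u - mean j v"
  by (simp add: mean_def algebra_simps sum_subtractf)

lemma mean_cmult: "mean j (\<lambda>x. c * u x) = c * mean j u"
  by (simp add: mean_def sum_distrib_left mult_ac)

lemma mean_const: "j \<in> J \<Longrightarrow> mean j (\<lambda>x. c) = c"
  by (simp add: mean_def sum_pr flip: sum_distrib_right)

lemma mean_mono: "(\<And>x. x \<in> K \<Longrightarrow> u x \<le> v x) \<Longrightarrow> mean j u \<le> mean j v"
  unfolding mean_def by (intro sum_mono mult_left_mono) auto

lemma mean_nonneg: "(\<And>x. 0 \<le> u x) \<Longrightarrow> 0 \<le> mean j u"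
  unfolding mean_def by (intro sum_nonneg mult_nonneg_nonneg) auto

lemma mean_of_bool: "x \<in> K \<Longrightarrow> mean j (\<lambda>y. of_bool (y = x)) = pr j x"
  by (simp add: mean_def of_bool_def if_distrib[of "\<lambda>z. _ * z"] cong: if_cong)

lemma variance_mean:
  assumes "j \<in> J"
  shows "mean j (\<lambda>x. (u x - mean j u)\<^sup>2) = mean j (\<lambda>x. (u x)\<^sup>2) - (mean j u)\<^sup>2"
proof -
  have "mean j (\<lambda>x. (u x - mean j u)\<^sup>2) = mean j (\<lambda>x. (u x)\<^sup>2 + (mean j u)\<^sup>2 - (2 * mean j u) * u x)"
    by (simp add: power2_diff mult_ac)
  also have "\<dots> = mean j (\<lambda>x. (u x)\<^sup>2) + (mean j u)\<^sup>2 - 2 * mean j u * mean j u"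
    using assms by (simp add: mean_diff mean_add mean_const mean_cmult)
  finally show ?thesis by (simp add: power2_eq_square)
qed

lemma mean_square_le: "j \<in> J \<Longrightarrow> (mean j u)\<^sup>2 \<le> mean j (\<lambda>x. (u x)\<^sup>2)"
  using variance_mean[of j u] mean_nonneg[of "\<lambda>x. (u x - mean j u)\<^sup>2" j] by simp

text \<open>The pointwise bound \<open>(a - b)^4 <= 8 * (a^4 + b^4)\<close> is used with
  \<open>b\<close> the mean, whose fourth power is at most the mean of the fourth powers by Jensen;
  16 is 8 + 8.\<close>

lemma fourth_moment_mean:
  assumes j: "j \<in> J"
  shows "mean j (\<lambda>x. (u x - mean j u) ^ 4) \<le> 16 * mean j (\<lambda>x. u x ^ 4)"
proof -
  let ?m = "mean j u"
  have pt: "(a - b) ^ 4 \<le> 8 * (a ^ 4 + b ^ 4)" for a b :: real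
  proof -
    have "(a - b)\<^sup>2 \<le> 2 * (a\<^sup>2 + b\<^sup>2)"
      using zero_le_power2[of "a + b"] by (simp add: power2_eq_square algebra_simps)
    then have "((a - b)\<^sup>2)\<^sup>2 \<le> (2 * (a\<^sup>2 + b\<^sup>2))\<^sup>2"
      by (intro power_mono) auto
    also have "\<dots> = 4 * (a\<^sup>2 + b\<^sup>2)\<^sup>2" by (subst power_mult_distrib) simp
    also have "(a\<^sup>2 + b\<^sup>2)\<^sup>2 \<le> 2 * ((a\<^sup>2)\<^sup>2 + (b\<^sup>2)\<^sup>2)"
      using zero_le_power2[of "a\<^sup>2 - b\<^sup>2"] by (simp add: power2_sum power2_diff)
    finally show ?thesis by (simp flip: power_mult)
  qed
  have m4: "?m ^ 4 \<le> mean j (\<lambda>x. u x ^ 4)"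
  proof -
    have "?m ^ 4 = (?m\<^sup>2)\<^sup>2" by simp
    also have "\<dots> \<le> (mean j (\<lambda>x. (u x)\<^sup>2))\<^sup>2"
      by (intro power_mono mean_square_le j) auto
    also have "\<dots> \<le> mean j (\<lambda>x. ((u x)\<^sup>2)\<^sup>2)"
      by (intro mean_square_le j)
    finally show ?thesis by simp
  qed
  have "mean j (\<lambda>x. (u x - ?m) ^ 4) \<le> mean j (\<lambda>x. 8 * (u x ^ 4 + ?m ^ 4))"
    by (intro mean_mono pt)
  also have "\<dots> = 8 * (mean j (\<lambda>x. u x ^ 4) + ?m ^ 4)"
    using j by (simp add: mean_cmult mean_add mean_const)
  finally show ?thesis using m4 by simp
qed

lemma resample_lin:
  assumes "j \<in> J" "\<And>v. u (X(j := v)) = u X"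
  shows "resample j (\<lambda>X. lin j (u X) X) X = 0"
  using resample_lin_power[where n = 1 and u = u, OF assms] assms(1)
  by (simp add: mean_diff mean_const)

lemma resample_lin_sq:
  assumes "j \<in> J" "\<And>v. u (X(j := v)) = u X"
  shows "resample j (\<lambda>X. (lin j (u X) X)\<^sup>2) X = (w j)\<^sup>2 * (mean j (\<lambda>x. (u X x)\<^sup>2) - (mean j (u X))\<^sup>2)"
  using resample_lin_power[where n = 2 and u = u, OF assms] assms(1)
  by (simp add: variance_mean)

lemma E_lin_mult:
  fixes g :: "_ \<Rightarrow> real"
  assumes "j \<in> J" "\<And>X v. u (X(j := v)) = u X" "\<And>X v. g (X(j := v)) = g X"
  shows "E (\<lambda>X. lin j (u X) X * g X) = 0"
  by (subst E_mult_indep[where j = j]) (use assms in \<open>auto simp: resample_lin[where u = u]\<close>)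

lemma E_lin_sq:
  assumes "j \<in> J" "\<And>X v. u (X(j := v)) = u X"
  shows "E (\<lambda>X. (lin j (u X) X)\<^sup>2) = (w j)\<^sup>2 * E (\<lambda>X. mean j (\<lambda>x. (u X x)\<^sup>2) - (mean j (u X))\<^sup>2)"
proof -
  have "E (\<lambda>X. (lin j (u X) X)\<^sup>2) = E (resample j (\<lambda>X. (lin j (u X) X)\<^sup>2))"
    using assms by (simp add: E_resample)
  also have "resample j (\<lambda>X. (lin j (u X) X)\<^sup>2)
      = (\<lambda>X. (w j)\<^sup>2 * (mean j (\<lambda>x. (u X x)\<^sup>2) - (mean j (u X))\<^sup>2))"
    using assms by (intro ext resample_lin_sq) auto
  finally show ?thesis by simp
qed

lemma E_mean: "E (\<lambda>X. mean j (\<lambda>x. u x X)) = mean j (\<lambda>x. E (u x))"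
  by (simp add: mean_def)

lemma E_lin_sq_le:
  assumes "j \<in> J" "\<And>X v. u (X(j := v)) = u X"
  shows "E (\<lambda>X. (lin j (u X) X)\<^sup>2) \<le> (w j)\<^sup>2 * mean j (\<lambda>x. E (\<lambda>X. (u X x)\<^sup>2))"
  unfolding E_lin_sq[where u = u, OF assms] E_mean[symmetric]
  by (intro mult_left_mono E_mono) auto

text \<open>Given the other observations \<open>lin j u\<close> has mean zero, so cross terms vanish
  and variances add.\<close>

lemma E_sum_lin_sq:
  assumes "A \<subseteq> J"
  shows "E (\<lambda>X. (\<Sum>j\<in>A. lin j u X)\<^sup>2)
    = (\<Sum>j\<in>A. (w j)\<^sup>2 * (mean j (\<lambda>x. (u x)\<^sup>2) - (mean j u)\<^sup>2))"
proof -
  have "finite A" using assms finite_J finite_subset by blast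
  then show ?thesis using assms
  proof (induction A)
    case (insert j A)
    have "E (\<lambda>X. (\<Sum>j\<in>insert j A. lin j u X)\<^sup>2)
      = E (\<lambda>X. (lin j u X)\<^sup>2 + (\<Sum>j\<in>A. lin j u X)\<^sup>2 + 2 * (lin j u X * (\<Sum>j\<in>A. lin j u X)))"
      using insert.hyps by (simp add: power2_sum mult_ac)
    also have "\<dots> = E (\<lambda>X. (lin j u X)\<^sup>2) + E (\<lambda>X. (\<Sum>j\<in>A. lin j u X)\<^sup>2)
        + 2 * E (\<lambda>X. lin j u X * (\<Sum>j\<in>A. lin j u X))"
      by simp
    also have "E (\<lambda>X. lin j u X * (\<Sum>j\<in>A. lin j u X)) = 0"
      using insert by (intro E_lin_mult[where u = "\<lambda>_. u"] sum.cong)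
        (auto intro!: lin_upd_other)
    also have "E (\<lambda>X. (lin j u X)\<^sup>2) = (w j)\<^sup>2 * (mean j (\<lambda>x. (u x)\<^sup>2) - (mean j u)\<^sup>2)"
      using E_lin_sq[where u = "\<lambda>_. u" and j = j] insert.prems by simp
    finally show ?case using insert by simp
  qed simp
qed

lemma S_eq_sum_lin: "x \<in> K \<Longrightarrow> S A x X = (\<Sum>j\<in>A. lin j (\<lambda>y. of_bool (y = x)) X)"
  by (simp add: S_def lin_of_bool)

lemma E_S_sq:
  assumes "A \<subseteq> J" "x \<in> K"
  shows "E (\<lambda>X. (S A x X)\<^sup>2) = (\<Sum>j\<in>A. (w j)\<^sup>2 * (pr j x - (pr j x)\<^sup>2))"
proof -
  have "(of_bool b :: real)\<^sup>2 = of_bool b" for b by (cases b) auto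
  then show ?thesis
    using E_sum_lin_sq[OF assms(1), of "\<lambda>y. of_bool (y = x)"] assms(2)
    by (simp add: S_eq_sum_lin mean_of_bool)
qed

lemma E_add: "E (\<lambda>X. f X + g X) = E f + E g" for f g :: "_ \<Rightarrow> real"
  by (rule Bochner_Integration.integral_add) simp_all

lemma E_diff: "E (\<lambda>X. f X - g X) = E f - E g" for f g :: "_ \<Rightarrow> real"
  by (rule Bochner_Integration.integral_diff) simp_all

lemma E_cmult: "E (\<lambda>X. c * f X) = c * E f" for f :: "_ \<Rightarrow> real"
  by (rule integral_mult_right_zero)

lemma E_sum: "E (\<lambda>X. \<Sum>i\<in>I. f i X) = (\<Sum>i\<in>I. E (f i))" for f :: "_ \<Rightarrow> _ \<Rightarrow> real"
  by (rule Bochner_Integration.integral_sum) simp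

section \<open>The degenerate quadratic form\<close>

text \<open>This is the \<pi> of the overview. It exceeds the variance of \<open>S J x\<close> only
  by the sum of \<open>(w j)^2 * (pr j x)^2\<close>.\<close>

definition wpr :: "'x \<Rightarrow> real" where
  "wpr x = (\<Sum>j\<in>J. (w j)\<^sup>2 * pr j x)"

text \<open>Half of the normalising variance: in the two-sample case \<sigma>^2 is
  \<open>2 * tau\<close>.\<close>

definition tau :: real where
  "tau = (\<Sum>x\<in>K. (wpr x)\<^sup>2)"

definition a :: "'j \<Rightarrow> ('j \<Rightarrow> 'x) \<Rightarrow> real" where
  "a j X = lin j (\<lambda>x. S (J - {j}) x X) X"

text \<open>Stated for any index set \<open>A\<close>, so that single observations can be split
  off.\<close>

definition W :: "'j set \<Rightarrow> ('j \<Rightarrow> 'x) \<Rightarrow> real" where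
  "W A X = (\<Sum>x\<in>K. (S A x X)\<^sup>2) - (\<Sum>j\<in>A. \<Sum>x\<in>K. (Z j x X)\<^sup>2)"

definition Q :: "'j \<Rightarrow> ('j \<Rightarrow> 'x) \<Rightarrow> real" where
  "Q j X = (w j)\<^sup>2 * (mean j (\<lambda>x. (S (J - {j}) x X)\<^sup>2) - (mean j (\<lambda>x. S (J - {j}) x X))\<^sup>2)"

lemma wpr_nonneg [simp]: "0 \<le> wpr x"
  unfolding wpr_def by (intro sum_nonneg) auto

text \<open>Turns sums over observations into sums over categories. Bounds for a single
  \<open>j\<close> are kept in the form \<open>(w j)^2 * mean j u\<close> so that this identity
  applies.\<close>

lemma sum_weighted_mean: "(\<Sum>j\<in>J. (w j)\<^sup>2 * mean j u) = (\<Sum>x\<in>K. wpr x * u x)"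
proof -
  have "(\<Sum>j\<in>J. (w j)\<^sup>2 * mean j u) = (\<Sum>j\<in>J. \<Sum>x\<in>K. (w j)\<^sup>2 * pr j x * u x)"
    by (simp add: mean_def sum_distrib_left mult.assoc)
  also have "\<dots> = (\<Sum>x\<in>K. \<Sum>j\<in>J. (w j)\<^sup>2 * pr j x * u x)"
    by (rule sum.swap)
  finally show ?thesis by (simp add: wpr_def sum_distrib_right)
qed

lemma W_insert:
  assumes "finite A" "j \<notin> A"
  shows "W (insert j A) X = W A X + 2 * lin j (\<lambda>x. S A x X) X"
proof -
  have "(\<Sum>x\<in>K. (S (insert j A) x X)\<^sup>2)
      = (\<Sum>x\<in>K. (Z j x X)\<^sup>2 + (S A x X)\<^sup>2 + 2 * (Z j x X * S A x X))"
    using assms by (simp add: S_insert power2_sum mult_ac)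
  also have "\<dots> = (\<Sum>x\<in>K. (Z j x X)\<^sup>2) + (\<Sum>x\<in>K. (S A x X)\<^sup>2) + 2 * lin j (\<lambda>x. S A x X) X"
    by (simp add: sum.distrib lin_def flip: sum_distrib_left)
  finally show ?thesis using assms by (simp add: W_def)
qed

lemma W_remove: "j \<in> J \<Longrightarrow> W J X - 2 * a j X = W (J - {j}) X"
  using W_insert[of "J - {j}" j X] by (simp add: insert_absorb a_def)

lemma W_upd_other: "j \<notin> A \<Longrightarrow> W A (X(j := v)) = W A X"
proof -
  assume "j \<notin> A"
  then have "l \<noteq> j" if "l \<in> A" for l using that by auto
  then show ?thesis using \<open>j \<notin> A\<close> by (simp add: W_def cong: sum.cong)
qed

lemma W_eq_sum: "W J X = (\<Sum>j\<in>J. a j X)"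
proof -
  have S: "S (J - {j}) x X = S J x X - Z j x X" if "j \<in> J" for j x
    using that by (simp add: S_def sum_diff1)
  have "(\<Sum>j\<in>J. a j X) = (\<Sum>j\<in>J. \<Sum>x\<in>K. Z j x X * S J x X - (Z j x X)\<^sup>2)"
    by (intro sum.cong refl) (simp add: a_def lin_def S algebra_simps power2_eq_square)
  also have "\<dots> = (\<Sum>j\<in>J. \<Sum>x\<in>K. Z j x X * S J x X) - (\<Sum>j\<in>J. \<Sum>x\<in>K. (Z j x X)\<^sup>2)"
    by (simp add: sum_subtractf)
  also have "(\<Sum>j\<in>J. \<Sum>x\<in>K. Z j x X * S J x X) = (\<Sum>x\<in>K. \<Sum>j\<in>J. Z j x X * S J x X)"
    by (rule sum.swap)
  also have "\<dots> = (\<Sum>x\<in>K. (S J x X)\<^sup>2)"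
    by (simp add: power2_eq_square S_def[of J] flip: sum_distrib_right)
  finally show ?thesis by (simp add: W_def)
qed

lemma resample_a: "j \<in> J \<Longrightarrow> resample j (a j) X = 0"
  using resample_lin[of j "\<lambda>X x. S (J - {j}) x X" X] by (simp add: a_def[abs_def])

lemma resample_a_sq: "j \<in> J \<Longrightarrow> resample j (\<lambda>X. (a j X)\<^sup>2) X = Q j X"
  using resample_lin_sq[of j "\<lambda>X x. S (J - {j}) x X" X] by (simp add: a_def[abs_def] Q_def)

lemma resample_of_real: "resample j (\<lambda>X. complex_of_real (f X)) X = of_real (resample j f X)"
  by (simp add: resample_def)

section \<open>Moments of single coordinates\<close>

definition zmom :: "'j \<Rightarrow> 'x \<Rightarrow> nat \<Rightarrow> real" where
  "zmom j x n = w j ^ n * mean j (\<lambda>y. (of_bool (y = x) - pr j x) ^ n)"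

lemma E_Z_power_mult:
  assumes "j \<in> J" "x \<in> K" "\<And>X v. g (X(j := v)) = g X"
  shows "E (\<lambda>X. Z j x X ^ n * g X) = zmom j x n * E g"
proof -
  have "resample j (\<lambda>X. Z j x X ^ n) X = zmom j x n" for X
    using resample_lin_power[where u = "\<lambda>_ y. of_bool (y = x)" and n = n and j = j and X = X] assms
    by (simp add: lin_of_bool mean_of_bool zmom_def)
  then show ?thesis
    using E_mult_indep[of j g "\<lambda>X. Z j x X ^ n"] assms by simp
qed

lemma zmom_1: "j \<in> J \<Longrightarrow> x \<in> K \<Longrightarrow> zmom j x (Suc 0) = 0"
  by (simp add: zmom_def mean_diff mean_of_bool mean_const)

lemma zmom_2: "j \<in> J \<Longrightarrow> x \<in> K \<Longrightarrow> zmom j x 2 = (w j)\<^sup>2 * (pr j x - (pr j x)\<^sup>2)"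
proof -
  have [simp]: "(of_bool b :: real)\<^sup>2 = of_bool b" for b by (cases b) auto
  assume "j \<in> J" "x \<in> K"
  then show ?thesis
    using variance_mean[of j "\<lambda>y. of_bool (y = x)"] by (simp add: zmom_def mean_of_bool)
qed

lemma zmom_2_le: "j \<in> J \<Longrightarrow> x \<in> K \<Longrightarrow> zmom j x 2 \<le> (w j)\<^sup>2 * pr j x"
  by (simp add: zmom_2 mult_left_mono)

text \<open>A centred indicator has modulus at most 1, so its fourth power is below its square, and
  one factor \<open>(w j)^2\<close> is left over.\<close>

lemma zmom_4_le: "j \<in> J \<Longrightarrow> x \<in> K \<Longrightarrow> zmom j x 4 \<le> (w j)\<^sup>2 * ((w j)\<^sup>2 * pr j x)"
proof -
  assume jx: "j \<in> J" "x \<in> K"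
  have "mean j (\<lambda>y. (of_bool (y = x) - pr j x) ^ 4) \<le> mean j (\<lambda>y. (of_bool (y = x) - pr j x)\<^sup>2)"
  proof (rule mean_mono)
    fix y
    have "\<bar>of_bool (y = x) - pr j x\<bar> \<le> 1" using pmf_le_1[of "q j" x] pmf_nonneg[of "q j" x]
      by (auto simp: of_bool_def)
    then have "(of_bool (y = x) - pr j x)\<^sup>2 \<le> 1" by (simp add: abs_square_le_1)
    then have "((of_bool (y = x) - pr j x)\<^sup>2)\<^sup>2 \<le> (of_bool (y = x) - pr j x)\<^sup>2"
      by (simp add: power2_eq_square mult_left_le)
    then show "(of_bool (y = x) - pr j x) ^ 4 \<le> (of_bool (y = x) - pr j x)\<^sup>2" by simp
  qed
  then have "(w j)\<^sup>2 * ((w j)\<^sup>2 * mean j (\<lambda>y. (of_bool (y = x) - pr j x) ^ 4))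
      \<le> (w j)\<^sup>2 * zmom j x 2"
    unfolding zmom_def by (intro mult_left_mono) auto
  also have "\<dots> \<le> (w j)\<^sup>2 * ((w j)\<^sup>2 * pr j x)"
    by (intro mult_left_mono zmom_2_le jx) auto
  finally show ?thesis by (simp add: zmom_def power4_eq_xxxx power2_eq_square mult_ac)
qed

lemma E_S_sq_eq_zmom:
  assumes "A \<subseteq> J" "x \<in> K"
  shows "E (\<lambda>X. (S A x X)\<^sup>2) = (\<Sum>j\<in>A. zmom j x 2)"
  unfolding E_S_sq[OF assms] by (intro sum.cong refl) (use assms zmom_2 in auto)

lemma E_S_sq_le: "A \<subseteq> J \<Longrightarrow> x \<in> K \<Longrightarrow> E (\<lambda>X. (S A x X)\<^sup>2) \<le> wpr x"
proof -
  assume A: "A \<subseteq> J" "x \<in> K"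
  have "(\<Sum>j\<in>A. zmom j x 2) \<le> (\<Sum>j\<in>A. (w j)\<^sup>2 * pr j x)"
    by (intro sum_mono zmom_2_le) (use A in auto)
  also have "\<dots> \<le> wpr x"
    unfolding wpr_def by (intro sum_mono2) (use A in auto)
  finally show ?thesis using A by (simp add: E_S_sq_eq_zmom)
qed

lemma E_S: "A \<subseteq> J \<Longrightarrow> x \<in> K \<Longrightarrow> E (S A x) = 0"
proof -
  assume A: "A \<subseteq> J" "x \<in> K"
  have "E (S A x) = (\<Sum>j\<in>A. E (Z j x))" by (simp add: S_def[abs_def])
  also have "\<dots> = 0"
    using A E_Z_power_mult[where n = 1 and g = "\<lambda>_. 1" and x = x] zmom_1[where x = x]
    by (intro sum.neutral) auto
  finally show ?thesis .
qed

end

text \<open>The last assumption reflects that observations are repeated: \<open>n\<close>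
  observations of equal law with weights of modulus \<open>1 / n\<close> contribute
  \<open>n * (1 / n)^2 * pr j x\<close>, which is \<open>\<bar>w j\<bar> * pr j x\<close>, to
  \<open>wpr x\<close>.\<close>

locale bounded_product_sample = product_sample +
  fixes \<beta> m M :: real
  assumes w_le: "\<And>j. j \<in> J \<Longrightarrow> \<bar>w j\<bar> \<le> \<beta>"
    and pr_le: "\<And>j x. j \<in> J \<Longrightarrow> x \<in> K \<Longrightarrow> pr j x \<le> m"
    and wpr_le: "\<And>x. x \<in> K \<Longrightarrow> wpr x \<le> M"
    and w_pr_le: "\<And>j x. j \<in> J \<Longrightarrow> x \<in> K \<Longrightarrow> \<bar>w j\<bar> * pr j x \<le> wpr x"
begin

lemma w_sq_le: "j \<in> J \<Longrightarrow> (w j)\<^sup>2 \<le> \<beta>\<^sup>2"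
  using w_le[of j] by (metis abs_ge_zero power2_abs power_mono)

text \<open>Adding an observation of second moment at most \<open>p\<close> contributes
  \<open>6 * (p * c A)\<close>, which is the cross term of \<open>3 * (p + c A)^2\<close>. The other
  mixed terms contain \<open>Z j\<close> or \<open>S A\<close> to the first power and
  vanish.\<close>

lemma E_S_4_le:
  assumes "A \<subseteq> J" "x \<in> K"
  shows "E (\<lambda>X. S A x X ^ 4) \<le> \<beta>\<^sup>2 * wpr x + 3 * (wpr x)\<^sup>2"
proof -
  \<comment> \<open>\<open>wpr x\<close> restricted to \<open>A\<close>: the induction needs a bound
    that grows with \<open>A\<close>, and monotonicity restores \<open>wpr x\<close> at the
    end.\<close>
  define c where "c = (\<lambda>A. \<Sum>j\<in>A. (w j)\<^sup>2 * pr j x)"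
  have "finite A" using assms finite_J finite_subset by blast
  then have "E (\<lambda>X. S A x X ^ 4) \<le> \<beta>\<^sup>2 * c A + 3 * (c A)\<^sup>2"
    using \<open>A \<subseteq> J\<close>
  proof (induction A)
    case (insert j A)
    then have j: "j \<in> J" "j \<notin> A" "A \<subseteq> J" "finite A" by auto
    define p where "p = (w j)\<^sup>2 * pr j x"
    have p0: "0 \<le> p" by (simp add: p_def)
    have c0: "0 \<le> c A" unfolding c_def by (intro sum_nonneg) auto
    have binom: "(z + s) ^ 4 = z ^ 4 * 1 + 4 * (z ^ 3 * s) + 6 * (z\<^sup>2 * s\<^sup>2) + 4 * (z ^ 1 * s ^ 3) + s ^ 4"
      for z s :: real
      by (simp add: power4_eq_xxxx power3_eq_cube power2_eq_square algebra_simps)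
    have "E (\<lambda>X. S (insert j A) x X ^ 4)
      = E (\<lambda>X. Z j x X ^ 4 * 1 + 4 * (Z j x X ^ 3 * S A x X) + 6 * (Z j x X ^ 2 * (S A x X)\<^sup>2)
            + 4 * (Z j x X ^ 1 * S A x X ^ 3) + S A x X ^ 4)"
      by (simp only: S_insert[OF j(4,2)] binom)
    also have "\<dots> = E (\<lambda>X. Z j x X ^ 4 * 1) + 4 * E (\<lambda>X. Z j x X ^ 3 * S A x X)
        + 6 * E (\<lambda>X. Z j x X ^ 2 * (S A x X)\<^sup>2) + 4 * E (\<lambda>X. Z j x X ^ 1 * S A x X ^ 3)
        + E (\<lambda>X. S A x X ^ 4)"
      unfolding E_add E_cmult ..
    also have "\<dots> = zmom j x 4 + 6 * (zmom j x 2 * E (\<lambda>X. (S A x X)\<^sup>2)) + E (\<lambda>X. S A x X ^ 4)"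
    proof -
      note Z = E_Z_power_mult[OF j(1) assms(2)]
      have "E (\<lambda>X. Z j x X ^ 4 * 1) = zmom j x 4 * E (\<lambda>_. 1)" by (rule Z) simp
      moreover have "E (\<lambda>X. Z j x X ^ 3 * S A x X) = zmom j x 3 * E (S A x)"
        by (rule Z) (simp add: j)
      moreover have "E (\<lambda>X. Z j x X ^ 2 * (S A x X)\<^sup>2) = zmom j x 2 * E (\<lambda>X. (S A x X)\<^sup>2)"
        by (rule Z) (simp add: j)
      moreover have "E (\<lambda>X. Z j x X ^ 1 * S A x X ^ 3) = zmom j x 1 * E (\<lambda>X. S A x X ^ 3)"
        by (rule Z) (simp add: j)
      moreover have "E (S A x) = 0" "zmom j x 1 = 0"
        using j assms by (simp_all add: E_S zmom_1)
      ultimately show ?thesis by simp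
    qed
    also have "\<dots> \<le> \<beta>\<^sup>2 * p + 6 * (p * c A) + (\<beta>\<^sup>2 * c A + 3 * (c A)\<^sup>2)"
    proof (intro add_mono mult_left_mono mult_mono)
      show "zmom j x 4 \<le> \<beta>\<^sup>2 * p"
        using zmom_4_le[OF j(1) assms(2)] mult_right_mono[OF w_sq_le[OF j(1)] p0] by (simp add: p_def)
      show "zmom j x 2 \<le> p" using zmom_2_le[OF j(1) assms(2)] by (simp add: p_def)
      show "E (\<lambda>X. (S A x X)\<^sup>2) \<le> c A"
        unfolding E_S_sq_eq_zmom[OF j(3) assms(2)] c_def
        by (intro sum_mono zmom_2_le) (use j assms in auto)
      show "0 \<le> E (\<lambda>X. (S A x X)\<^sup>2)" by (intro E_nonneg) auto
      show "E (\<lambda>X. S A x X ^ 4) \<le> \<beta>\<^sup>2 * c A + 3 * (c A)\<^sup>2" using insert by simp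
    qed (use p0 in auto)
    also have "\<dots> \<le> \<beta>\<^sup>2 * (p + c A) + 3 * (p + c A)\<^sup>2"
      by (simp add: power2_eq_square algebra_simps)
    also have "p + c A = c (insert j A)"
      using j by (simp add: c_def p_def)
    finally show ?case .
  qed (simp add: c_def)
  also have "\<dots> \<le> \<beta>\<^sup>2 * wpr x + 3 * (wpr x)\<^sup>2"
  proof -
    have "c A \<le> wpr x" unfolding c_def wpr_def by (intro sum_mono2) (use assms in auto)
    moreover have "0 \<le> c A" unfolding c_def by (intro sum_nonneg) auto
    ultimately show ?thesis by (intro add_mono mult_left_mono power_mono) auto
  qed
  finally show ?thesis .
qed

lemma sum_E_a_sq_le: "(\<Sum>j\<in>J. E (\<lambda>X. (a j X)\<^sup>2)) \<le> tau"
proof -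
  have "(\<Sum>j\<in>J. E (\<lambda>X. (a j X)\<^sup>2)) \<le> (\<Sum>j\<in>J. (w j)\<^sup>2 * mean j wpr)"
  proof (rule sum_mono)
    fix j assume j: "j \<in> J"
    have "E (\<lambda>X. (a j X)\<^sup>2) \<le> (w j)\<^sup>2 * mean j (\<lambda>x. E (\<lambda>X. (S (J - {j}) x X)\<^sup>2))"
      unfolding a_def by (rule E_lin_sq_le[where u = "\<lambda>X x. S (J - {j}) x X", OF j]) simp
    also have "\<dots> \<le> (w j)\<^sup>2 * mean j wpr"
      by (intro mult_left_mono mean_mono E_S_sq_le) auto
    finally show "E (\<lambda>X. (a j X)\<^sup>2) \<le> \<dots>" .
  qed
  also have "\<dots> = tau"
    unfolding sum_weighted_mean tau_def by (simp add: power2_eq_square)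
  finally show ?thesis .
qed

lemma sum_E_a_4_le: "(\<Sum>j\<in>J. E (\<lambda>X. a j X ^ 4)) \<le> 16 * \<beta>\<^sup>2 * (\<beta>\<^sup>2 + 3 * M) * tau"
proof -
  have "(\<Sum>j\<in>J. E (\<lambda>X. a j X ^ 4)) \<le> (\<Sum>j\<in>J. 16 * \<beta>\<^sup>2 * ((w j)\<^sup>2 * mean j (\<lambda>x. \<beta>\<^sup>2 * wpr x + 3 * (wpr x)\<^sup>2)))"
  proof (rule sum_mono)
    fix j assume j: "j \<in> J"
    let ?u = "\<lambda>X x. S (J - {j}) x X"
    have "E (\<lambda>X. a j X ^ 4) = E (resample j (\<lambda>X. a j X ^ 4))"
      by (rule E_resample[OF j, symmetric])
    also have "\<dots> = E (\<lambda>X. w j ^ 4 * mean j (\<lambda>x. (?u X x - mean j (?u X)) ^ 4))"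
      unfolding a_def by (intro E_cong resample_lin_power j) simp
    also have "\<dots> \<le> E (\<lambda>X. w j ^ 4 * (16 * mean j (\<lambda>x. ?u X x ^ 4)))"
      by (intro E_mono mult_left_mono fourth_moment_mean j) auto
    also have "\<dots> = 16 * w j ^ 4 * mean j (\<lambda>x. E (\<lambda>X. ?u X x ^ 4))"
      by (simp add: E_mean)
    also have "\<dots> \<le> 16 * w j ^ 4 * mean j (\<lambda>x. \<beta>\<^sup>2 * wpr x + 3 * (wpr x)\<^sup>2)"
      by (intro mult_left_mono mean_mono E_S_4_le) auto
    also have "\<dots> = 16 * ((w j)\<^sup>2 * ((w j)\<^sup>2 * mean j (\<lambda>x. \<beta>\<^sup>2 * wpr x + 3 * (wpr x)\<^sup>2)))"
      by (simp add: power4_eq_xxxx power2_eq_square mult_ac)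
    \<comment> \<open>One factor \<open>(w j)^2\<close> is given up to \<beta>^2, the other is kept
      for \<open>sum_weighted_mean\<close>.\<close>
    also have "\<dots> \<le> 16 * (\<beta>\<^sup>2 * ((w j)\<^sup>2 * mean j (\<lambda>x. \<beta>\<^sup>2 * wpr x + 3 * (wpr x)\<^sup>2)))"
      by (intro mult_left_mono mult_right_mono w_sq_le j mult_nonneg_nonneg mean_nonneg) auto
    finally show "E (\<lambda>X. a j X ^ 4) \<le> 16 * \<beta>\<^sup>2 * ((w j)\<^sup>2 * mean j (\<lambda>x. \<beta>\<^sup>2 * wpr x + 3 * (wpr x)\<^sup>2))"
      by (simp add: mult.assoc)
  qed
  also have "\<dots> = 16 * \<beta>\<^sup>2 * (\<Sum>x\<in>K. wpr x * (\<beta>\<^sup>2 * wpr x + 3 * (wpr x)\<^sup>2))"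
    by (simp add: sum_weighted_mean flip: sum_distrib_left)
  also have "\<dots> \<le> 16 * \<beta>\<^sup>2 * (\<Sum>x\<in>K. (\<beta>\<^sup>2 + 3 * M) * (wpr x)\<^sup>2)"
  proof (intro mult_left_mono sum_mono)
    fix x assume "x \<in> K"
    then have "3 * wpr x * (wpr x)\<^sup>2 \<le> 3 * M * (wpr x)\<^sup>2"
      by (intro mult_right_mono) (auto simp: wpr_le)
    then show "wpr x * (\<beta>\<^sup>2 * wpr x + 3 * (wpr x)\<^sup>2) \<le> (\<beta>\<^sup>2 + 3 * M) * (wpr x)\<^sup>2"
      by (simp add: algebra_simps power2_eq_square)
  qed auto
  finally show ?thesis by (simp add: tau_def mult.assoc flip: sum_distrib_left)
qed

text \<open>Conditional Jensen: \<open>Q j\<close> is the conditional mean of the square of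
  \<open>a j\<close>. The fourth moment bound for the \<open>a j\<close> thereby serves for the
  \<open>Q j\<close> too.\<close>

lemma E_Q_sq_le: "j \<in> J \<Longrightarrow> E (\<lambda>X. (Q j X)\<^sup>2) \<le> E (\<lambda>X. a j X ^ 4)"
proof -
  assume j: "j \<in> J"
  have "E (\<lambda>X. (Q j X)\<^sup>2) \<le> E (resample j (\<lambda>X. ((a j X)\<^sup>2)\<^sup>2))"
  proof (rule E_mono)
    fix X
    have "Q j X = mean j (\<lambda>x. (a j (X(j := x)))\<^sup>2)"
      using resample_a_sq[OF j, of X] by (simp add: resample_eq_sum[OF j] mean_def)
    then have "(Q j X)\<^sup>2 \<le> mean j (\<lambda>x. ((a j (X(j := x)))\<^sup>2)\<^sup>2)"
      using mean_square_le[OF j, of "\<lambda>x. (a j (X(j := x)))\<^sup>2"] by simp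
    then show "(Q j X)\<^sup>2 \<le> resample j (\<lambda>X. ((a j X)\<^sup>2)\<^sup>2) X"
      by (simp add: resample_eq_sum[OF j] mean_def)
  qed
  also have "\<dots> = E (\<lambda>X. ((a j X)\<^sup>2)\<^sup>2)" by (rule E_resample[OF j])
  finally show ?thesis by simp
qed

section \<open>Concentration of the sum of the conditional variances\<close>

lemma M_nonneg: "x \<in> K \<Longrightarrow> 0 \<le> M"
  using wpr_nonneg[of x] wpr_le[of x] by linarith

lemma sum_Z_sq_le:
  assumes "j \<in> J" "X \<in> set_pmf P"
  shows "(\<Sum>x\<in>K. (Z j x X)\<^sup>2) \<le> 2 * (w j)\<^sup>2"
proof -
  have "(\<Sum>x\<in>K. (Z j x X)\<^sup>2) \<le> (\<Sum>x\<in>K. (w j)\<^sup>2 * (of_bool (X j = x) + pr j x))"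
  proof (rule sum_mono)
    fix x
    have "\<bar>of_bool (X j = x) - pr j x\<bar> \<le> 1"
      using pmf_le_1[of "q j" x] pmf_nonneg[of "q j" x] by (auto simp: of_bool_def)
    then have "\<bar>of_bool (X j = x) - pr j x\<bar> * \<bar>of_bool (X j = x) - pr j x\<bar> \<le> \<bar>of_bool (X j = x) - pr j x\<bar>"
      by (rule mult_left_le) simp
    also have "\<dots> \<le> of_bool (X j = x) + pr j x"
      using abs_triangle_ineq4[of "of_bool (X j = x)" "pr j x"] by simp
    finally have "(of_bool (X j = x) - pr j x)\<^sup>2 \<le> of_bool (X j = x) + pr j x"
      by (simp add: power2_eq_square)
    then show "(Z j x X)\<^sup>2 \<le> (w j)\<^sup>2 * (of_bool (X j = x) + pr j x)"
      by (simp add: Z_def power_mult_distrib mult_left_mono)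
  qed
  also have "\<dots> = (w j)\<^sup>2 * ((\<Sum>x\<in>K. of_bool (X j = x)) + (\<Sum>x\<in>K. pr j x))"
    by (simp add: sum.distrib flip: sum_distrib_left)
  also have "(\<Sum>x\<in>K. of_bool (X j = x)) = (1::real)"
    using P_in_K[OF assms(2,1)] by (simp add: of_bool_def)
  also have "(\<Sum>x\<in>K. pr j x) = 1" by (rule sum_pr[OF assms(1)])
  finally show ?thesis by simp
qed

lemma E_Z_sq: "j \<in> J \<Longrightarrow> x \<in> K \<Longrightarrow> E (\<lambda>X. (Z j x X)\<^sup>2) = zmom j x 2"
  using E_Z_power_mult[of j x "\<lambda>_. 1" 2] by simp

text \<open>A nonnegative variable bounded by \<open>B\<close> has variance at most \<open>B\<close>
  times its mean. Here \<open>B\<close> is \<open>2 * M * \<beta>^2\<close>, because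
  \<open>wpr\<close> is at most \<open>M\<close> and \<open>sum_Z_sq_le\<close> bounds the squared
  length of \<open>Z j\<close>.\<close>

lemma E_diag_sq_le:
  assumes j: "j \<in> J"
  shows "E (\<lambda>X. (\<Sum>x\<in>K. wpr x * ((Z j x X)\<^sup>2 - zmom j x 2))\<^sup>2)
    \<le> 2 * M * \<beta>\<^sup>2 * ((w j)\<^sup>2 * mean j wpr)"
proof -
  define g where "g = (\<lambda>X. \<Sum>x\<in>K. wpr x * (Z j x X)\<^sup>2)"
  have K: "K \<noteq> {}" using sum_pr[OF j] by auto
  then have M: "0 \<le> M" using M_nonneg by auto
  have g0: "0 \<le> g X" for X unfolding g_def by (intro sum_nonneg) auto
  have Eg: "E g = (\<Sum>x\<in>K. wpr x * zmom j x 2)"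
  proof -
    have "E g = (\<Sum>x\<in>K. E (\<lambda>X. wpr x * (Z j x X)\<^sup>2))" unfolding g_def by (rule E_sum)
    also have "\<dots> = (\<Sum>x\<in>K. wpr x * zmom j x 2)"
      by (intro sum.cong refl) (simp only: E_cmult E_Z_sq[OF j])
    finally show ?thesis .
  qed
  have g_eq: "(\<Sum>x\<in>K. wpr x * ((Z j x X)\<^sup>2 - zmom j x 2)) = g X - E g" for X
    unfolding Eg by (simp add: g_def right_diff_distrib sum_subtractf)
  have "E (\<lambda>X. (g X - E g)\<^sup>2) = E (\<lambda>X. ((g X)\<^sup>2 + (E g)\<^sup>2) - 2 * E g * g X)"
    by (simp add: power2_diff mult_ac)
  also have "\<dots> = E (\<lambda>X. (g X)\<^sup>2) - (E g)\<^sup>2"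
    unfolding E_diff E_add E_cmult E_const by (simp add: power2_eq_square)
  also have "\<dots> \<le> E (\<lambda>X. (g X)\<^sup>2)" by simp
  also have "\<dots> \<le> E (\<lambda>X. 2 * M * \<beta>\<^sup>2 * g X)"
  proof (rule E_mono)
    fix X assume X: "X \<in> set_pmf P"
    have "g X \<le> (\<Sum>x\<in>K. M * (Z j x X)\<^sup>2)"
      unfolding g_def by (intro sum_mono mult_right_mono wpr_le) auto
    also have "\<dots> = M * (\<Sum>x\<in>K. (Z j x X)\<^sup>2)" by (simp add: sum_distrib_left)
    also have "\<dots> \<le> M * (2 * \<beta>\<^sup>2)"
      using sum_Z_sq_le[OF j X] w_sq_le[OF j] M by (intro mult_left_mono) auto
    finally have "g X \<le> 2 * M * \<beta>\<^sup>2" by simp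
    then show "(g X)\<^sup>2 \<le> 2 * M * \<beta>\<^sup>2 * g X"
      using g0 by (simp add: power2_eq_square mult_right_mono)
  qed
  also have "\<dots> = 2 * M * \<beta>\<^sup>2 * E g" by (rule E_cmult)
  also have "\<dots> \<le> 2 * M * \<beta>\<^sup>2 * ((w j)\<^sup>2 * mean j wpr)"
  proof (intro mult_left_mono)
    have "E g \<le> (\<Sum>x\<in>K. wpr x * ((w j)\<^sup>2 * pr j x))"
      unfolding Eg by (intro sum_mono mult_left_mono zmom_2_le j) auto
    then show "E g \<le> (w j)\<^sup>2 * mean j wpr"
      by (simp add: mean_def sum_distrib_left mult_ac)
  qed (use M in auto)
  finally show ?thesis by (simp add: g_eq)
qed

text \<open>
  Adding an observation \<open>j\<close> changes the centred sum by a term whose conditional expectation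
  given the other observations vanishes, so the second moments of the increments add up.
\<close>
lemma variance_weighted_S_sq:
  assumes "A \<subseteq> J"
  shows "E (\<lambda>X. (\<Sum>x\<in>K. wpr x * ((S A x X)\<^sup>2 - (\<Sum>j\<in>A. zmom j x 2)))\<^sup>2)
    \<le> (\<Sum>j\<in>A. 8 * ((w j)\<^sup>2 * mean j (\<lambda>x. wpr x ^ 3)) + 4 * M * \<beta>\<^sup>2 * ((w j)\<^sup>2 * mean j wpr))"
proof -
  define R where "R = (\<lambda>A X. \<Sum>x\<in>K. wpr x * ((S A x X)\<^sup>2 - (\<Sum>j\<in>A. zmom j x 2)))"
  have "finite A" using assms finite_J finite_subset by blast
  then have "E (\<lambda>X. (R A X)\<^sup>2)
    \<le> (\<Sum>j\<in>A. 8 * ((w j)\<^sup>2 * mean j (\<lambda>x. wpr x ^ 3)) + 4 * M * \<beta>\<^sup>2 * ((w j)\<^sup>2 * mean j wpr))"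
    using assms
  proof (induction A)
    case empty
    show ?case by (simp add: R_def)
  next
    case (insert j A)
    then have j: "j \<in> J" "j \<notin> A" "A \<subseteq> J" "finite A" by auto
    \<comment> \<open>The increment of \<open>R\<close> is \<open>2 * L + G\<close>, with
      \<open>L\<close> linear in \<open>Z j\<close> and \<open>G\<close> the centred squares of its
      coordinates.\<close>
    define L where "L = (\<lambda>X. lin j (\<lambda>x. wpr x * S A x X) X)"
    define G where "G = (\<lambda>X. \<Sum>x\<in>K. wpr x * ((Z j x X)\<^sup>2 - zmom j x 2))"
    have R_upd: "R A (X(j := v)) = R A X" for X v
      by (simp add: R_def j)
    have "R (insert j A) X = (\<Sum>x\<in>K. wpr x * ((S A x X)\<^sup>2 - (\<Sum>j\<in>A. zmom j x 2))
        + 2 * (Z j x X * (wpr x * S A x X)) + wpr x * ((Z j x X)\<^sup>2 - zmom j x 2))" for X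
      unfolding R_def using j
      by (intro sum.cong refl) (simp add: S_insert power2_sum algebra_simps)
    then have R_insert: "R (insert j A) X = R A X + 2 * L X + G X" for X
      by (simp add: sum.distrib R_def L_def G_def lin_def flip: sum_distrib_left)
    have RL: "E (\<lambda>X. L X * R A X) = 0"
      unfolding L_def by (rule E_lin_mult[where u = "\<lambda>X x. wpr x * S A x X"]) (simp_all add: j R_upd)
    have "E (\<lambda>X. G X * R A X) = E (\<lambda>X. \<Sum>x\<in>K. wpr x * (Z j x X ^ 2 * R A X - zmom j x 2 * R A X))"
      by (simp only: G_def sum_distrib_right mult.assoc left_diff_distrib)
    also have "\<dots> = 0"
      unfolding E_sum E_cmult E_diff using j
      by (intro sum.neutral ballI) (simp add: E_Z_power_mult[where g = "R A"] R_upd)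
    finally have RG: "E (\<lambda>X. G X * R A X) = 0" .
    have "E (\<lambda>X. (R (insert j A) X)\<^sup>2)
        \<le> E (\<lambda>X. (R A X)\<^sup>2 + 4 * (L X * R A X) + 2 * (G X * R A X) + 8 * (L X)\<^sup>2 + 2 * (G X)\<^sup>2)"
    proof (rule E_mono)
      fix X
      \<comment> \<open>\<open>L\<close> and \<open>G\<close> stem from the same observation and
        need not be orthogonal; the square of the sum is bounded without computing their
        covariance.\<close>
      have "(2 * L X + G X)\<^sup>2 \<le> 8 * (L X)\<^sup>2 + 2 * (G X)\<^sup>2"
        using zero_le_power2[of "2 * L X - G X"] by (simp add: power2_eq_square algebra_simps)
      then show "(R (insert j A) X)\<^sup>2
          \<le> (R A X)\<^sup>2 + 4 * (L X * R A X) + 2 * (G X * R A X) + 8 * (L X)\<^sup>2 + 2 * (G X)\<^sup>2"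
        unfolding R_insert by (simp add: power2_eq_square algebra_simps)
    qed
    also have "\<dots> = E (\<lambda>X. (R A X)\<^sup>2) + 8 * E (\<lambda>X. (L X)\<^sup>2) + 2 * E (\<lambda>X. (G X)\<^sup>2)"
      unfolding E_add E_cmult RL RG by simp
    also have "E (\<lambda>X. (L X)\<^sup>2) \<le> (w j)\<^sup>2 * mean j (\<lambda>x. wpr x ^ 3)"
    proof -
      have "E (\<lambda>X. (L X)\<^sup>2) \<le> (w j)\<^sup>2 * mean j (\<lambda>x. E (\<lambda>X. (wpr x * S A x X)\<^sup>2))"
        unfolding L_def by (rule E_lin_sq_le[where u = "\<lambda>X x. wpr x * S A x X"]) (simp_all add: j)
      also have "\<dots> \<le> (w j)\<^sup>2 * mean j (\<lambda>x. wpr x ^ 3)"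
      proof (intro mult_left_mono mean_mono)
        fix x assume x: "x \<in> K"
        have "E (\<lambda>X. (wpr x * S A x X)\<^sup>2) = (wpr x)\<^sup>2 * E (\<lambda>X. (S A x X)\<^sup>2)"
          unfolding power_mult_distrib by (rule E_cmult)
        also have "\<dots> \<le> (wpr x)\<^sup>2 * wpr x"
          by (intro mult_left_mono E_S_sq_le j x) auto
        finally show "E (\<lambda>X. (wpr x * S A x X)\<^sup>2) \<le> wpr x ^ 3"
          by (simp add: power3_eq_cube power2_eq_square)
      qed auto
      finally show ?thesis .
    qed
    also have "E (\<lambda>X. (G X)\<^sup>2) \<le> 2 * M * \<beta>\<^sup>2 * ((w j)\<^sup>2 * mean j wpr)"
      unfolding G_def by (rule E_diag_sq_le[OF j(1)])
    finally show ?case using insert by simp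
  qed
  then show ?thesis by (simp add: R_def)
qed

lemma sum_K_wpr_power_le:
  "(\<Sum>x\<in>K. wpr x * wpr x ^ 3) \<le> M\<^sup>2 * tau"
proof -
  have "wpr x * wpr x ^ 3 \<le> M\<^sup>2 * (wpr x)\<^sup>2" if "x \<in> K" for x
  proof -
    have "(wpr x)\<^sup>2 * (wpr x)\<^sup>2 \<le> M\<^sup>2 * (wpr x)\<^sup>2"
      using that by (intro mult_right_mono power_mono wpr_le) auto
    then show ?thesis by (simp add: power3_eq_cube power2_eq_square mult_ac)
  qed
  then show ?thesis unfolding tau_def sum_distrib_left by (rule sum_mono)
qed

lemma E_abs_weighted_S_sq_le:
  "E (\<lambda>X. \<bar>\<Sum>x\<in>K. wpr x * ((S J x X)\<^sup>2 - (\<Sum>j\<in>J. zmom j x 2))\<bar>)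
    \<le> sqrt ((8 * M\<^sup>2 + 4 * M * \<beta>\<^sup>2) * tau)"
proof (rule order_trans[OF expectation_abs_le_sqrt real_sqrt_le_mono])
  have "E (\<lambda>X. (\<Sum>x\<in>K. wpr x * ((S J x X)\<^sup>2 - (\<Sum>j\<in>J. zmom j x 2)))\<^sup>2)
    \<le> (\<Sum>j\<in>J. 8 * ((w j)\<^sup>2 * mean j (\<lambda>x. wpr x ^ 3)) + 4 * M * \<beta>\<^sup>2 * ((w j)\<^sup>2 * mean j wpr))"
    by (rule variance_weighted_S_sq) simp
  also have "\<dots> = 8 * (\<Sum>x\<in>K. wpr x * wpr x ^ 3) + 4 * M * \<beta>\<^sup>2 * (\<Sum>x\<in>K. wpr x * wpr x)"
    unfolding sum.distrib sum_distrib_left[symmetric] sum_weighted_mean ..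
  also have "(\<Sum>x\<in>K. wpr x * wpr x) = tau" by (simp add: tau_def power2_eq_square)
  also have "8 * (\<Sum>x\<in>K. wpr x * wpr x ^ 3) + 4 * M * \<beta>\<^sup>2 * tau \<le> (8 * M\<^sup>2 + 4 * M * \<beta>\<^sup>2) * tau"
    using sum_K_wpr_power_le by (simp add: distrib_right)
  finally show "E (\<lambda>X. (\<Sum>x\<in>K. wpr x * ((S J x X)\<^sup>2 - (\<Sum>j\<in>J. zmom j x 2)))\<^sup>2) \<le> \<dots>" .
qed simp

lemma E_abs_S_le: "A \<subseteq> J \<Longrightarrow> x \<in> K \<Longrightarrow> E (\<lambda>X. \<bar>S A x X\<bar>) \<le> sqrt M"
  by (rule order_trans[OF expectation_abs_le_sqrt real_sqrt_le_mono])
     (auto intro: order_trans[OF E_S_sq_le wpr_le])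

text \<open>Dropping observation \<open>j\<close> changes the square by
  \<open>2 * Z j x * S (J - {j}) x + (Z j x)^2\<close>. Independence separates the factors of the
  first product, with mean moduli at most \<open>2 * wpr x\<close> and \<open>sqrt M\<close>. The
  factor \<open>wpr x\<close> in the bound becomes \<open>tau\<close> after summation against
  \<open>wpr\<close>.\<close>

lemma E_abs_S_sq_diff_le:
  assumes j: "j \<in> J" and x: "x \<in> K"
  shows "E (\<lambda>X. \<bar>(S (J - {j}) x X)\<^sup>2 - (S J x X)\<^sup>2\<bar>) \<le> (4 * sqrt M + \<beta>) * wpr x"
proof -
  let ?S = "S (J - {j}) x"
  have S: "S J x X = Z j x X + ?S X" for X
    using S_insert[of "J - {j}" j x X] j by (simp add: insert_absorb)
  have rZ: "resample j (\<lambda>X. \<bar>Z j x X\<bar>) X \<le> 2 * wpr x" for X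
  proof -
    have "resample j (\<lambda>X. \<bar>Z j x X\<bar>) X = mean j (\<lambda>y. \<bar>w j\<bar> * \<bar>of_bool (y = x) - pr j x\<bar>)"
      by (simp add: resample_eq_sum[OF j] mean_def Z_def abs_mult)
    also have "\<dots> \<le> mean j (\<lambda>y. \<bar>w j\<bar> * (of_bool (y = x) + pr j x))"
      proof (intro mean_mono mult_left_mono)
      show "\<bar>of_bool (y = x) - pr j x\<bar> \<le> of_bool (y = x) + pr j x" for y
        using abs_triangle_ineq4[of "of_bool (y = x)" "pr j x"] by simp
    qed simp
    also have "\<dots> = 2 * (\<bar>w j\<bar> * pr j x)"
      using j x by (simp add: mean_cmult mean_add mean_of_bool mean_const)
    also have "\<dots> \<le> 2 * wpr x" using w_pr_le[OF j x] by simp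
    finally show ?thesis .
  qed
  have "E (\<lambda>X. \<bar>(?S X)\<^sup>2 - (S J x X)\<^sup>2\<bar>) \<le> E (\<lambda>X. 2 * (\<bar>Z j x X\<bar> * \<bar>?S X\<bar>) + (Z j x X)\<^sup>2)"
  proof (rule E_mono)
    fix X
    have "(?S X)\<^sup>2 - (S J x X)\<^sup>2 = - (2 * (Z j x X * ?S X) + (Z j x X)\<^sup>2)"
      by (simp add: S power2_sum)
    then show "\<bar>(?S X)\<^sup>2 - (S J x X)\<^sup>2\<bar> \<le> 2 * (\<bar>Z j x X\<bar> * \<bar>?S X\<bar>) + (Z j x X)\<^sup>2"
      using abs_triangle_ineq[of "2 * (Z j x X * ?S X)" "(Z j x X)\<^sup>2"]
      by (simp add: abs_mult del: abs_triangle_ineq)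
  qed
  also have "\<dots> = 2 * E (\<lambda>X. \<bar>Z j x X\<bar> * \<bar>?S X\<bar>) + zmom j x 2"
    unfolding E_add E_cmult E_Z_sq[OF j x] ..
  also have "E (\<lambda>X. \<bar>Z j x X\<bar> * \<bar>?S X\<bar>) = E (\<lambda>X. resample j (\<lambda>X. \<bar>Z j x X\<bar>) X * \<bar>?S X\<bar>)"
    by (rule E_mult_indep[OF j]) simp
  also have "\<dots> \<le> E (\<lambda>X. 2 * wpr x * \<bar>?S X\<bar>)"
    by (intro E_mono mult_right_mono rZ) auto
  also have "\<dots> = 2 * wpr x * E (\<lambda>X. \<bar>?S X\<bar>)" by (rule E_cmult)
  also have "\<dots> \<le> 2 * wpr x * sqrt M"
    by (intro mult_left_mono E_abs_S_le x) auto
  also have "zmom j x 2 \<le> \<beta> * wpr x"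
  proof -
    have "zmom j x 2 \<le> \<bar>w j\<bar> * (\<bar>w j\<bar> * pr j x)"
      using zmom_2_le[OF j x] by (simp add: power2_eq_square flip: mult.assoc)
    also have "\<dots> \<le> \<beta> * wpr x"
      using w_le[OF j] by (intro mult_mono w_pr_le j x) auto
    finally show ?thesis .
  qed
  finally show ?thesis by (simp add: algebra_simps)
qed

text \<open>Averaging the leave-one-out vector against \<open>pr j\<close> gives a sum of
  independent linear forms in the other observations, so \<open>E_sum_lin_sq\<close>
  applies.\<close>

lemma E_mean_S_sq_le:
  assumes j: "j \<in> J"
  shows "E (\<lambda>X. (mean j (\<lambda>x. S (J - {j}) x X))\<^sup>2) \<le> (\<Sum>x\<in>K. wpr x * (pr j x)\<^sup>2)"
proof -
  have "mean j (\<lambda>x. S (J - {j}) x X) = (\<Sum>l\<in>J - {j}. lin l (pr j) X)" for X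
    unfolding mean_def S_def lin_def sum_distrib_left by (subst sum.swap) (simp add: mult.commute)
  then have "E (\<lambda>X. (mean j (\<lambda>x. S (J - {j}) x X))\<^sup>2)
      = (\<Sum>l\<in>J - {j}. (w l)\<^sup>2 * (mean l (\<lambda>x. (pr j x)\<^sup>2) - (mean l (pr j))\<^sup>2))"
    by (simp add: E_sum_lin_sq)
  also have "\<dots> \<le> (\<Sum>l\<in>J - {j}. (w l)\<^sup>2 * mean l (\<lambda>x. (pr j x)\<^sup>2))"
    by (intro sum_mono mult_left_mono) auto
  also have "\<dots> \<le> (\<Sum>l\<in>J. (w l)\<^sup>2 * mean l (\<lambda>x. (pr j x)\<^sup>2))"
    by (intro sum_mono2 mult_nonneg_nonneg mean_nonneg) auto
  finally show ?thesis by (simp add: sum_weighted_mean)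
qed

lemma sum_w_pr_sq_le:
  assumes x: "x \<in> K"
  shows "(\<Sum>j\<in>J. (w j)\<^sup>2 * (pr j x)\<^sup>2) \<le> m * wpr x"
proof -
  have "(w j)\<^sup>2 * (pr j x)\<^sup>2 \<le> m * ((w j)\<^sup>2 * pr j x)" if "j \<in> J" for j
  proof -
    have "(w j)\<^sup>2 * pr j x * pr j x \<le> (w j)\<^sup>2 * pr j x * m"
      by (intro mult_left_mono pr_le that x) auto
    then show ?thesis by (simp add: power2_eq_square mult_ac)
  qed
  then show ?thesis unfolding wpr_def sum_distrib_left by (rule sum_mono)
qed

lemma E_abs_sum_Q_le:
  "E (\<lambda>X. \<bar>(\<Sum>j\<in>J. Q j X) - tau\<bar>)
    \<le> (4 * sqrt M + \<beta> + 2 * m) * tau + sqrt ((8 * M\<^sup>2 + 4 * M * \<beta>\<^sup>2) * tau)"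
proof -
  let ?S = "\<lambda>j x X. S (J - {j}) x X"
  \<comment> \<open>\<open>T1\<close> is the cost of completing each leave-one-out sum to
    \<open>S J\<close>, \<open>T2\<close> collects the squared conditional means in the
    \<open>Q j\<close>, \<open>T3\<close> is the fluctuation of the completed quadratic form about
    its mean, and \<open>T4\<close> is the gap between \<open>tau\<close> and that mean.\<close>
  define T1 where "T1 = (\<lambda>X. \<Sum>j\<in>J. (w j)\<^sup>2 * mean j (\<lambda>x. \<bar>(?S j x X)\<^sup>2 - (S J x X)\<^sup>2\<bar>))"
  define T2 where "T2 = (\<lambda>X. \<Sum>j\<in>J. (w j)\<^sup>2 * (mean j (\<lambda>x. ?S j x X))\<^sup>2)"
  define T3 where "T3 = (\<lambda>X. \<Sum>x\<in>K. wpr x * ((S J x X)\<^sup>2 - (\<Sum>j\<in>J. zmom j x 2)))"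
  define T4 where "T4 = (\<Sum>x\<in>K. wpr x * (\<Sum>j\<in>J. (w j)\<^sup>2 * (pr j x)\<^sup>2))"
  have T40: "0 \<le> T4" unfolding T4_def by (intro sum_nonneg mult_nonneg_nonneg) auto
  have T20: "0 \<le> T2 X" for X unfolding T2_def by (intro sum_nonneg mult_nonneg_nonneg) auto
  have tau: "tau = (\<Sum>x\<in>K. wpr x * (\<Sum>j\<in>J. zmom j x 2)) + T4"
  proof -
    have "wpr x = (\<Sum>j\<in>J. zmom j x 2) + (\<Sum>j\<in>J. (w j)\<^sup>2 * (pr j x)\<^sup>2)" if "x \<in> K" for x
      unfolding wpr_def sum.distrib[symmetric]
      by (intro sum.cong refl) (use that in \<open>simp add: zmom_2 algebra_simps\<close>)
    then have "(\<Sum>x\<in>K. wpr x * wpr x)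
        = (\<Sum>x\<in>K. wpr x * ((\<Sum>j\<in>J. zmom j x 2) + (\<Sum>j\<in>J. (w j)\<^sup>2 * (pr j x)\<^sup>2)))"
      by (intro sum.cong refl) simp
    then show ?thesis by (simp add: tau_def T4_def power2_eq_square distrib_left sum.distrib)
  qed
  have pt: "\<bar>(\<Sum>j\<in>J. Q j X) - tau\<bar> \<le> T1 X + T2 X + \<bar>T3 X\<bar> + T4" for X
  proof -
    define D where "D = (\<Sum>j\<in>J. (w j)\<^sup>2 * mean j (\<lambda>x. (?S j x X)\<^sup>2 - (S J x X)\<^sup>2))"
    have "(\<Sum>j\<in>J. Q j X) = (\<Sum>j\<in>J. (w j)\<^sup>2 * mean j (\<lambda>x. (?S j x X)\<^sup>2)) - T2 X"
      by (simp add: Q_def T2_def right_diff_distrib sum_subtractf)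
    also have "(\<Sum>j\<in>J. (w j)\<^sup>2 * mean j (\<lambda>x. (?S j x X)\<^sup>2))
        = D + (\<Sum>j\<in>J. (w j)\<^sup>2 * mean j (\<lambda>x. (S J x X)\<^sup>2))"
      by (simp add: D_def mean_diff right_diff_distrib sum_subtractf)
    also have "(\<Sum>j\<in>J. (w j)\<^sup>2 * mean j (\<lambda>x. (S J x X)\<^sup>2)) = (\<Sum>x\<in>K. wpr x * (S J x X)\<^sup>2)"
      by (rule sum_weighted_mean)
    also have "\<dots> = T3 X + (\<Sum>x\<in>K. wpr x * (\<Sum>j\<in>J. zmom j x 2))"
      by (simp add: T3_def right_diff_distrib sum_subtractf)
    finally have "(\<Sum>j\<in>J. Q j X) - tau = D - T2 X + T3 X - T4"
      by (simp add: tau)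
    moreover have "\<bar>D\<bar> \<le> T1 X"
      unfolding D_def T1_def
    proof (rule order_trans[OF sum_abs sum_mono])
      fix j
      have "\<bar>mean j u\<bar> \<le> mean j (\<lambda>x. \<bar>u x\<bar>)" for u
        unfolding mean_def by (rule order_trans[OF sum_abs]) (simp add: abs_mult)
      then show "\<bar>(w j)\<^sup>2 * mean j (\<lambda>x. (?S j x X)\<^sup>2 - (S J x X)\<^sup>2)\<bar>
          \<le> (w j)\<^sup>2 * mean j (\<lambda>x. \<bar>(?S j x X)\<^sup>2 - (S J x X)\<^sup>2\<bar>)"
        by (simp add: abs_mult mult_left_mono)
    qed
    ultimately show ?thesis using T20[of X] T40 by linarith
  qed
  have wpr_sq: "(\<Sum>x\<in>K. wpr x * (c * wpr x)) = c * tau" for c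
    by (simp add: tau_def sum_distrib_left power2_eq_square mult_ac)
  have E1: "E T1 \<le> (4 * sqrt M + \<beta>) * tau"
  proof -
    have "E T1 = (\<Sum>j\<in>J. (w j)\<^sup>2 * mean j (\<lambda>x. E (\<lambda>X. \<bar>(?S j x X)\<^sup>2 - (S J x X)\<^sup>2\<bar>)))"
      unfolding T1_def E_sum E_cmult E_mean ..
    also have "\<dots> \<le> (\<Sum>j\<in>J. (w j)\<^sup>2 * mean j (\<lambda>x. (4 * sqrt M + \<beta>) * wpr x))"
      by (intro sum_mono mult_left_mono mean_mono E_abs_S_sq_diff_le) auto
    finally show ?thesis by (simp only: sum_weighted_mean wpr_sq)
  qed
  have T4: "T4 \<le> m * tau"
  proof -
    have "T4 \<le> (\<Sum>x\<in>K. wpr x * (m * wpr x))"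
      unfolding T4_def by (intro sum_mono mult_left_mono sum_w_pr_sq_le) auto
    then show ?thesis by (simp only: wpr_sq)
  qed
  have E2: "E T2 \<le> m * tau"
  proof -
    have "E T2 = (\<Sum>j\<in>J. (w j)\<^sup>2 * E (\<lambda>X. (mean j (\<lambda>x. ?S j x X))\<^sup>2))"
      unfolding T2_def E_sum E_cmult ..
    also have "\<dots> \<le> (\<Sum>j\<in>J. (w j)\<^sup>2 * (\<Sum>x\<in>K. wpr x * (pr j x)\<^sup>2))"
      by (intro sum_mono mult_left_mono E_mean_S_sq_le) auto
    also have "\<dots> = T4"
      unfolding T4_def sum_distrib_left by (subst sum.swap) (simp add: mult_ac)
    finally show ?thesis using T4 by simp
  qed
  have E3: "E (\<lambda>X. \<bar>T3 X\<bar>) \<le> sqrt ((8 * M\<^sup>2 + 4 * M * \<beta>\<^sup>2) * tau)"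
    unfolding T3_def by (rule E_abs_weighted_S_sq_le)
  have "E (\<lambda>X. \<bar>(\<Sum>j\<in>J. Q j X) - tau\<bar>) \<le> E (\<lambda>X. T1 X + T2 X + \<bar>T3 X\<bar> + T4)"
    by (intro E_mono pt)
  also have "\<dots> = E T1 + E T2 + E (\<lambda>X. \<bar>T3 X\<bar>) + T4"
    unfolding E_add E_const ..
  finally show ?thesis using E1 E2 E3 T4 by (simp add: algebra_simps)
qed

end

section \<open>Normal approximation of the quadratic form\<close>

lemma abs_mult_le_sq:
  fixes x y l :: real
  assumes "0 < l"
  shows "\<bar>x\<bar> * \<bar>y\<bar> \<le> (l * y\<^sup>2 + x\<^sup>2 / l) / 2"
proof -
  have "0 \<le> (l * \<bar>y\<bar> - \<bar>x\<bar>)\<^sup>2 / l" using assms by simp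
  also have "\<dots> = l * y\<^sup>2 + x\<^sup>2 / l - 2 * (\<bar>x\<bar> * \<bar>y\<bar>)"
    using assms by (simp add: field_simps power2_eq_square)
  finally show ?thesis by simp
qed

context bounded_product_sample
begin

theorem char_W_bound:
  assumes tau: "0 < tau" and beta: "0 < \<beta>"
  shows "cmod (E (\<lambda>X. iexp (t * (W J X / sqrt (2 * tau)))) - complex_of_real (exp (- (t\<^sup>2) / 2)))
    \<le> \<bar>t\<bar> * (t\<^sup>2 * (9 / 2 * sqrt (4 * \<beta>\<^sup>2 * (\<beta>\<^sup>2 + 3 * M) / tau))
        + \<bar>t\<bar> * (4 * sqrt M + \<beta> + 2 * m + sqrt ((8 * M\<^sup>2 + 4 * M * \<beta>\<^sup>2) / tau)))"
proof -
  define \<sigma> where "\<sigma> = sqrt (2 * tau)"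
  have \<sigma>: "0 < \<sigma>" "\<sigma>\<^sup>2 = 2 * tau" using tau by (simp_all add: \<sigma>_def)
  have \<sigma>4: "\<sigma> ^ 4 = 4 * tau\<^sup>2"
    using \<sigma>(2) power_mult[of \<sigma> 2 2] by (simp add: power_mult_distrib)
  have "K \<noteq> {}" using tau by (auto simp: tau_def)
  then have M: "0 \<le> M" using M_nonneg by auto
  define a' where "a' = (\<lambda>j X. a j X / \<sigma>)"
  define Q' where "Q' = (\<lambda>j X. Q j X / (2 * tau))"
  \<comment> \<open>The bound of \<open>sum_E_a_4_le\<close> divided by \<open>\<sigma> ^ 4\<close>,
    that is by \<open>4 * tau ^ 2\<close>.\<close>
  define \<eta> where "\<eta> = 4 * \<beta>\<^sup>2 * (\<beta>\<^sup>2 + 3 * M) / tau"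
  \<comment> \<open>The weight in \<open>abs_mult_le_sq\<close>. Second moments sum to at most 1/2
    and fourth ones to at most \<eta>, so this choice makes both parts of order \<open>l\<close>.
    Each of the two third-order sums is then at most \<open>3 / 4 * l\<close>, and with the
    coefficients 2 and 4 this gives \<open>9 / 2 * l\<close>.\<close>
  define l where "l = sqrt \<eta>"
  have \<eta>: "0 < \<eta>" unfolding \<eta>_def using tau beta M
    by (intro divide_pos_pos mult_pos_pos add_pos_nonneg) auto
  then have l: "0 < l" "l * l = \<eta>" by (simp_all add: l_def)
  have W_diff: "W J X / \<sigma> - 2 * a' j X = W (J - {j}) X / \<sigma>" if "j \<in> J" for j X
    using W_remove[OF that, of X] by (simp add: a'_def diff_divide_distrib[symmetric])
  have indep: "iexp (s * (W (J - {j}) (X(j := x)) / \<sigma>)) = iexp (s * (W (J - {j}) X / \<sigma>))" for s j X x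
    by (simp add: W_upd_other)
  have mean': "E (\<lambda>X. complex_of_real (a' j X) * iexp (s * (W J X / \<sigma> - 2 * a' j X))) = 0"
    if j: "j \<in> J" for j s
  proof -
    have "resample j (\<lambda>X. complex_of_real (a' j X)) X = 0" for X
    proof -
      have "resample j (a' j) X = resample j (a j) X / \<sigma>"
        unfolding a'_def resample_def by simp
      then show ?thesis by (simp add: resample_of_real resample_a[OF j])
    qed
    then show ?thesis
      unfolding W_diff[OF j] by (subst E_mult_indep[OF j indep]) simp
  qed
  have var': "E (\<lambda>X. complex_of_real ((a' j X)\<^sup>2) * iexp (s * (W J X / \<sigma> - 2 * a' j X)))
      = E (\<lambda>X. complex_of_real (Q' j X) * iexp (s * (W J X / \<sigma> - 2 * a' j X)))"
    if j: "j \<in> J" for j s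
  proof -
    have "resample j (\<lambda>X. complex_of_real ((a' j X)\<^sup>2)) X = complex_of_real (Q' j X)" for X
    proof -
      have "resample j (\<lambda>X. (a' j X)\<^sup>2) X = resample j (\<lambda>X. (a j X)\<^sup>2) X / (2 * tau)"
        unfolding a'_def resample_def power_divide \<sigma>(2) by simp
      then show ?thesis unfolding resample_of_real by (simp only: resample_a_sq[OF j] Q'_def)
    qed
    then show ?thesis
      unfolding W_diff[OF j] by (subst E_mult_indep[OF j indep]) simp
  qed
  have W': "W J X / \<sigma> = (\<Sum>j\<in>J. a' j X)" for X
    by (simp add: W_eq_sum a'_def sum_divide_distrib)
  have A2: "(\<Sum>j\<in>J. E (\<lambda>X. (a' j X)\<^sup>2)) \<le> 1 / 2"
  proof -
    have "(\<Sum>j\<in>J. E (\<lambda>X. (a' j X)\<^sup>2)) = (\<Sum>j\<in>J. E (\<lambda>X. (a j X)\<^sup>2)) / (2 * tau)"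
      unfolding a'_def power_divide \<sigma>(2) by (simp add: sum_divide_distrib)
    also have "\<dots> \<le> tau / (2 * tau)"
      using tau by (intro divide_right_mono sum_E_a_sq_le) auto
    finally show ?thesis using tau by simp
  qed
  have A4: "(\<Sum>j\<in>J. E (\<lambda>X. a' j X ^ 4)) \<le> \<eta>"
  proof -
    have "(\<Sum>j\<in>J. E (\<lambda>X. a' j X ^ 4)) = (\<Sum>j\<in>J. E (\<lambda>X. a j X ^ 4)) / (4 * tau\<^sup>2)"
      unfolding a'_def power_divide \<sigma>4 by (simp add: sum_divide_distrib)
    also have "\<dots> \<le> 16 * \<beta>\<^sup>2 * (\<beta>\<^sup>2 + 3 * M) * tau / (4 * tau\<^sup>2)"
      using tau by (intro divide_right_mono sum_E_a_4_le) auto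
    also have "\<dots> = \<eta>"
      using tau by (simp add: \<eta>_def power2_eq_square)
    finally show ?thesis .
  qed
  have Q2: "(\<Sum>j\<in>J. E (\<lambda>X. (Q' j X)\<^sup>2)) \<le> \<eta>"
  proof -
    have "(\<Sum>j\<in>J. E (\<lambda>X. (Q' j X)\<^sup>2)) \<le> (\<Sum>j\<in>J. E (\<lambda>X. a' j X ^ 4))"
    proof (rule sum_mono)
      fix j assume j: "j \<in> J"
      have "E (\<lambda>X. (Q' j X)\<^sup>2) = E (\<lambda>X. (Q j X)\<^sup>2) / (4 * tau\<^sup>2)"
        unfolding Q'_def power_divide power_mult_distrib by simp
      also have "\<dots> \<le> E (\<lambda>X. a j X ^ 4) / (4 * tau\<^sup>2)"
        by (intro divide_right_mono E_Q_sq_le j) auto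
      also have "\<dots> = E (\<lambda>X. a' j X ^ 4)"
        unfolding a'_def power_divide \<sigma>4 by simp
      finally show "E (\<lambda>X. (Q' j X)\<^sup>2) \<le> E (\<lambda>X. a' j X ^ 4)" .
    qed
    with A4 show ?thesis by linarith
  qed
  have A3: "(\<Sum>j\<in>J. E (\<lambda>X. \<bar>a' j X\<bar> ^ 3)) \<le> (l * (1 / 2) + \<eta> / l) / 2"
  proof -
    have "(\<Sum>j\<in>J. E (\<lambda>X. \<bar>a' j X\<bar> ^ 3)) \<le> (\<Sum>j\<in>J. E (\<lambda>X. l / 2 * (a' j X)\<^sup>2 + 1 / (2 * l) * a' j X ^ 4))"
    proof (intro sum_mono E_mono)
      fix j X
      have "\<bar>a' j X\<bar> ^ 3 = \<bar>(a' j X)\<^sup>2\<bar> * \<bar>a' j X\<bar>"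
        by (simp add: power3_eq_cube power2_eq_square abs_mult)
      also have "\<dots> \<le> (l * (a' j X)\<^sup>2 + ((a' j X)\<^sup>2)\<^sup>2 / l) / 2"
        by (rule abs_mult_le_sq[OF l(1)])
      finally show "\<bar>a' j X\<bar> ^ 3 \<le> l / 2 * (a' j X)\<^sup>2 + 1 / (2 * l) * a' j X ^ 4"
        by (simp add: add_divide_distrib)
    qed
    also have "\<dots> = l / 2 * (\<Sum>j\<in>J. E (\<lambda>X. (a' j X)\<^sup>2)) + 1 / (2 * l) * (\<Sum>j\<in>J. E (\<lambda>X. a' j X ^ 4))"
      unfolding E_add E_cmult sum.distrib sum_distrib_left[symmetric] ..
    also have "\<dots> \<le> l / 2 * (1 / 2) + 1 / (2 * l) * \<eta>"
      using l(1) by (intro add_mono mult_left_mono A2 A4) auto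
    finally show ?thesis by (simp add: add_divide_distrib)
  qed
  have AQ: "(\<Sum>j\<in>J. E (\<lambda>X. \<bar>Q' j X\<bar> * \<bar>a' j X\<bar>)) \<le> (l * (1 / 2) + \<eta> / l) / 2"
  proof -
    have "(\<Sum>j\<in>J. E (\<lambda>X. \<bar>Q' j X\<bar> * \<bar>a' j X\<bar>)) \<le> (\<Sum>j\<in>J. E (\<lambda>X. l / 2 * (a' j X)\<^sup>2 + 1 / (2 * l) * (Q' j X)\<^sup>2))"
    proof (intro sum_mono E_mono)
      fix j X
      show "\<bar>Q' j X\<bar> * \<bar>a' j X\<bar> \<le> l / 2 * (a' j X)\<^sup>2 + 1 / (2 * l) * (Q' j X)\<^sup>2"
        using abs_mult_le_sq[OF l(1), of "Q' j X" "a' j X"] by (simp add: add_divide_distrib)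
    qed
    also have "\<dots> = l / 2 * (\<Sum>j\<in>J. E (\<lambda>X. (a' j X)\<^sup>2)) + 1 / (2 * l) * (\<Sum>j\<in>J. E (\<lambda>X. (Q' j X)\<^sup>2))"
      unfolding E_add E_cmult sum.distrib sum_distrib_left[symmetric] ..
    also have "\<dots> \<le> l / 2 * (1 / 2) + 1 / (2 * l) * \<eta>"
      using l(1) by (intro add_mono mult_left_mono A2 Q2) auto
    finally show ?thesis by (simp add: add_divide_distrib)
  qed
  have QB: "E (\<lambda>X. \<bar>(\<Sum>j\<in>J. Q' j X) - 1 / 2\<bar>)
      \<le> (4 * sqrt M + \<beta> + 2 * m + sqrt ((8 * M\<^sup>2 + 4 * M * \<beta>\<^sup>2) / tau)) / 2"
  proof -
    have "\<bar>(\<Sum>j\<in>J. Q' j X) - 1 / 2\<bar> = 1 / (2 * tau) * \<bar>(\<Sum>j\<in>J. Q j X) - tau\<bar>" for X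
    proof -
      have "(\<Sum>j\<in>J. Q' j X) - 1 / 2 = 1 / (2 * tau) * ((\<Sum>j\<in>J. Q j X) - tau)"
        using tau by (simp add: Q'_def field_simps flip: sum_divide_distrib)
      then show ?thesis using tau by (simp add: abs_mult)
    qed
    then have "E (\<lambda>X. \<bar>(\<Sum>j\<in>J. Q' j X) - 1 / 2\<bar>) = 1 / (2 * tau) * E (\<lambda>X. \<bar>(\<Sum>j\<in>J. Q j X) - tau\<bar>)"
      by (simp only: E_cmult)
    also have "\<dots> \<le> 1 / (2 * tau) * ((4 * sqrt M + \<beta> + 2 * m) * tau + sqrt ((8 * M\<^sup>2 + 4 * M * \<beta>\<^sup>2) * tau))"
      using tau by (intro mult_left_mono E_abs_sum_Q_le) auto
    also have "sqrt ((8 * M\<^sup>2 + 4 * M * \<beta>\<^sup>2) * tau) = sqrt ((8 * M\<^sup>2 + 4 * M * \<beta>\<^sup>2) / tau) * tau"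
    proof -
      have "(8 * M\<^sup>2 + 4 * M * \<beta>\<^sup>2) * tau = (8 * M\<^sup>2 + 4 * M * \<beta>\<^sup>2) / tau * tau\<^sup>2"
        using tau by (simp add: power2_eq_square)
      then show ?thesis using tau by (simp only: real_sqrt_mult real_sqrt_power) simp
    qed
    also have "1 / (2 * tau) * ((4 * sqrt M + \<beta> + 2 * m) * tau + sqrt ((8 * M\<^sup>2 + 4 * M * \<beta>\<^sup>2) / tau) * tau)
        = (4 * sqrt M + \<beta> + 2 * m + sqrt ((8 * M\<^sup>2 + 4 * M * \<beta>\<^sup>2) / tau)) / 2"
      unfolding distrib_right[symmetric] using tau by simp
    finally show ?thesis .
  qed
  have "cmod (E (\<lambda>X. iexp (t * (W J X / \<sigma>))) - complex_of_real (exp (- (t\<^sup>2) / 2)))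
    \<le> \<bar>t\<bar> * (t\<^sup>2 * (2 * (\<Sum>j\<in>J. E (\<lambda>X. \<bar>a' j X\<bar> ^ 3)) + 4 * (\<Sum>j\<in>J. E (\<lambda>X. \<bar>Q' j X\<bar> * \<bar>a' j X\<bar>)))
        + 2 * \<bar>t\<bar> * E (\<lambda>X. \<bar>(\<Sum>j\<in>J. Q' j X) - 1 / 2\<bar>))"
    by (rule stein_tikhomirov[where W = "\<lambda>X. W J X / \<sigma>" and a = a' and Q = Q', OF finite_P W' mean' var'])
  also have "\<dots> \<le> \<bar>t\<bar> * (t\<^sup>2 * (2 * ((l * (1 / 2) + \<eta> / l) / 2) + 4 * ((l * (1 / 2) + \<eta> / l) / 2))
        + 2 * \<bar>t\<bar> * ((4 * sqrt M + \<beta> + 2 * m + sqrt ((8 * M\<^sup>2 + 4 * M * \<beta>\<^sup>2) / tau)) / 2))"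
    by (intro mult_left_mono add_mono A3 AQ QB) auto
  also have "\<eta> / l = l" using l by (simp add: field_simps)
  also have "2 * ((l * (1 / 2) + l) / 2) + 4 * ((l * (1 / 2) + l) / 2) = 9 / 2 * l" by simp
  finally show ?thesis by (simp add: \<sigma>_def l_def \<eta>_def)
qed

section \<open>The linear term in \<xi> and the diagonal term\<close>

lemma E_abs_linear_le:
  "E (\<lambda>X. \<bar>\<Sum>x\<in>K. \<xi> x * S J x X\<bar>) \<le> sqrt (M * (\<Sum>x\<in>K. (\<xi> x)\<^sup>2))"
proof (rule order_trans[OF expectation_abs_le_sqrt real_sqrt_le_mono])
  have "(\<Sum>x\<in>K. \<xi> x * S J x X) = (\<Sum>j\<in>J. lin j \<xi> X)" for X
    unfolding S_def lin_def sum_distrib_left by (subst sum.swap) (simp add: mult.commute)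
  then have "E (\<lambda>X. (\<Sum>x\<in>K. \<xi> x * S J x X)\<^sup>2)
      = (\<Sum>j\<in>J. (w j)\<^sup>2 * (mean j (\<lambda>x. (\<xi> x)\<^sup>2) - (mean j \<xi>)\<^sup>2))"
    by (simp add: E_sum_lin_sq)
  also have "\<dots> \<le> (\<Sum>j\<in>J. (w j)\<^sup>2 * mean j (\<lambda>x. (\<xi> x)\<^sup>2))"
    by (intro sum_mono mult_left_mono) auto
  also have "\<dots> = (\<Sum>x\<in>K. wpr x * (\<xi> x)\<^sup>2)" by (rule sum_weighted_mean)
  also have "\<dots> \<le> M * (\<Sum>x\<in>K. (\<xi> x)\<^sup>2)"
    unfolding sum_distrib_left by (intro sum_mono mult_right_mono wpr_le) auto
  finally show "E (\<lambda>X. (\<Sum>x\<in>K. \<xi> x * S J x X)\<^sup>2) \<le> M * (\<Sum>x\<in>K. (\<xi> x)\<^sup>2)" .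
qed simp

text \<open>On the support of \<open>P\<close> the squared length of \<open>Z j\<close> differs from
  \<open>(w j)^2\<close> by exactly \<open>(w j)^2 * (mean j (pr j) - 2 * pr j (X j))\<close>, whose
  mean modulus is at most \<open>3 * (w j)^2 * mean j (pr j)\<close>. By \<open>w_pr_le\<close>,
  \<open>(w j)^2 * mean j (pr j)\<close> is at most \<open>tau\<close>, once for each
  observation.\<close>

lemma E_abs_diag_le:
  "E (\<lambda>X. \<bar>(\<Sum>j\<in>J. \<Sum>x\<in>K. (Z j x X)\<^sup>2) - (\<Sum>j\<in>J. (w j)\<^sup>2)\<bar>) \<le> 3 * real (card J) * tau"
proof -
  have pt: "\<bar>(\<Sum>x\<in>K. (Z j x X)\<^sup>2) - (w j)\<^sup>2\<bar> \<le> (w j)\<^sup>2 * (2 * pr j (X j) + mean j (pr j))"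
    if j: "j \<in> J" and X: "X \<in> set_pmf P" for j X
  proof -
    have "(Z j x X)\<^sup>2 = (w j)\<^sup>2 * (of_bool (X j = x) - 2 * (of_bool (X j = x) * pr j x) + pr j x * pr j x)" for x
      by (simp add: Z_def power_mult_distrib power2_eq_square of_bool_def algebra_simps)
    then have "(\<Sum>x\<in>K. (Z j x X)\<^sup>2)
      = (w j)\<^sup>2 * ((\<Sum>x\<in>K. of_bool (X j = x)) - 2 * (\<Sum>x\<in>K. of_bool (X j = x) * pr j x) + mean j (pr j))"
      by (simp add: sum.distrib sum_subtractf mean_def flip: sum_distrib_left)
    also have "(\<Sum>x\<in>K. of_bool (X j = x)) = (1::real)"
      using P_in_K[OF X j] by (simp add: of_bool_def)
    also have "(\<Sum>x\<in>K. of_bool (X j = x) * pr j x) = pr j (X j)"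
      using P_in_K[OF X j] by (simp add: of_bool_def if_distrib[of "\<lambda>z. z * _"] cong: if_cong)
    finally have "(\<Sum>x\<in>K. (Z j x X)\<^sup>2) - (w j)\<^sup>2 = (w j)\<^sup>2 * (mean j (pr j) - 2 * pr j (X j))"
      by (simp add: algebra_simps)
    moreover have "\<bar>mean j (pr j) - 2 * pr j (X j)\<bar> \<le> 2 * pr j (X j) + mean j (pr j)"
      using mean_nonneg[of "pr j" j] pmf_nonneg[of "q j" "X j"] by (simp only: abs_le_iff) simp
    ultimately show ?thesis by (simp add: abs_mult mult_left_mono)
  qed
  have Epr: "E (\<lambda>X. pr j (X j)) = mean j (pr j)" if j: "j \<in> J" for j
  proof -
    have "E (\<lambda>X. pr j (X j)) = E (resample j (\<lambda>X. pr j (X j)))"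
      by (rule E_resample[OF j, symmetric])
    also have "resample j (\<lambda>X. pr j (X j)) = (\<lambda>_. mean j (pr j))"
      by (simp add: fun_eq_iff resample_eq_sum[OF j] mean_def)
    finally show ?thesis by simp
  qed
  have "E (\<lambda>X. \<bar>(\<Sum>j\<in>J. \<Sum>x\<in>K. (Z j x X)\<^sup>2) - (\<Sum>j\<in>J. (w j)\<^sup>2)\<bar>)
      \<le> E (\<lambda>X. \<Sum>j\<in>J. (w j)\<^sup>2 * (2 * pr j (X j) + mean j (pr j)))"
    unfolding sum_subtractf[symmetric]
    by (intro E_mono order_trans[OF sum_abs sum_mono] pt) auto
  also have "\<dots> = (\<Sum>j\<in>J. (w j)\<^sup>2 * (2 * E (\<lambda>X. pr j (X j)) + mean j (pr j)))"
    unfolding E_sum E_cmult E_add E_const ..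
  also have "\<dots> = 3 * (\<Sum>j\<in>J. (w j)\<^sup>2 * mean j (pr j))"
    unfolding sum_distrib_left by (intro sum.cong refl) (simp add: Epr)
  also have "(\<Sum>j\<in>J. (w j)\<^sup>2 * mean j (pr j)) \<le> (\<Sum>j\<in>J. tau)"
  proof (rule sum_mono)
    fix j assume j: "j \<in> J"
    have "(w j)\<^sup>2 * mean j (pr j) = (\<Sum>x\<in>K. (\<bar>w j\<bar> * pr j x)\<^sup>2)"
      by (simp add: mean_def sum_distrib_left power_mult_distrib power2_eq_square[of "pr _ _"])
    also have "\<dots> \<le> tau"
      unfolding tau_def by (intro sum_mono power_mono w_pr_le j) auto
    finally show "(w j)\<^sup>2 * mean j (pr j) \<le> tau" .
  qed
  finally show ?thesis by simp
qed

text \<open>\<open>T\<close> is \<open>W J\<close> plus twice the linear term plus the diagonal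
  term. As \<open>iexp\<close> is Lipschitz, these two cost
  \<open>\<bar>t\<bar> / sqrt (2 * tau)\<close> times their mean moduli.\<close>

theorem char_statistic_bound:
  fixes \<xi>
  defines "T \<equiv> \<lambda>X. (\<Sum>x\<in>K. (\<xi> x + S J x X)\<^sup>2) - (\<Sum>j\<in>J. (w j)\<^sup>2) - (\<Sum>x\<in>K. (\<xi> x)\<^sup>2)"
  assumes tau: "0 < tau" and beta: "0 < \<beta>"
  shows "cmod (E (\<lambda>X. iexp (t * (T X / sqrt (2 * tau)))) - complex_of_real (exp (- (t\<^sup>2) / 2)))
    \<le> \<bar>t\<bar> * ((2 * sqrt (M * (\<Sum>x\<in>K. (\<xi> x)\<^sup>2)) + 3 * real (card J) * tau) / sqrt (2 * tau))
      + \<bar>t\<bar> * (t\<^sup>2 * (9 / 2 * sqrt (4 * \<beta>\<^sup>2 * (\<beta>\<^sup>2 + 3 * M) / tau))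
        + \<bar>t\<bar> * (4 * sqrt M + \<beta> + 2 * m + sqrt ((8 * M\<^sup>2 + 4 * M * \<beta>\<^sup>2) / tau)))"
proof -
  define \<sigma> where "\<sigma> = sqrt (2 * tau)"
  have \<sigma>: "0 < \<sigma>" using tau by (simp add: \<sigma>_def)
  define L where "L = (\<lambda>X. \<Sum>x\<in>K. \<xi> x * S J x X)"
  define D where "D = (\<lambda>X. (\<Sum>j\<in>J. \<Sum>x\<in>K. (Z j x X)\<^sup>2) - (\<Sum>j\<in>J. (w j)\<^sup>2))"
  have T: "T X - W J X = 2 * L X + D X" for X
    by (simp add: T_def W_def L_def D_def power2_sum sum.distrib sum_distrib_left mult.assoc)
  have "cmod (E (\<lambda>X. iexp (t * (T X / \<sigma>))) - E (\<lambda>X. iexp (t * (W J X / \<sigma>))))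
      = cmod (E (\<lambda>X. iexp (t * (T X / \<sigma>)) - iexp (t * (W J X / \<sigma>))))"
    by (subst Bochner_Integration.integral_diff) simp_all
  also have "\<dots> \<le> E (\<lambda>X. cmod (iexp (t * (T X / \<sigma>)) - iexp (t * (W J X / \<sigma>))))"
    by (rule integral_norm_bound)
  also have "\<dots> \<le> E (\<lambda>X. \<bar>t\<bar> / \<sigma> * (2 * \<bar>L X\<bar> + \<bar>D X\<bar>))"
  proof (rule E_mono)
    fix X
    have "cmod (iexp (t * (T X / \<sigma>)) - iexp (t * (W J X / \<sigma>))) \<le> \<bar>t * (T X / \<sigma>) - t * (W J X / \<sigma>)\<bar>"
      by (rule cmod_iexp_diff)
    also have "t * (T X / \<sigma>) - t * (W J X / \<sigma>) = t / \<sigma> * (2 * L X + D X)"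
      unfolding T[symmetric] by (simp add: right_diff_distrib diff_divide_distrib)
    also have "\<bar>\<dots>\<bar> = \<bar>t\<bar> / \<sigma> * \<bar>2 * L X + D X\<bar>"
      using \<sigma> by (simp add: abs_mult)
    also have "\<dots> \<le> \<bar>t\<bar> / \<sigma> * (2 * \<bar>L X\<bar> + \<bar>D X\<bar>)"
      using \<sigma> by (intro mult_left_mono) auto
    finally show "cmod (iexp (t * (T X / \<sigma>)) - iexp (t * (W J X / \<sigma>))) \<le> \<dots>" .
  qed
  also have "\<dots> = \<bar>t\<bar> / \<sigma> * (2 * E (\<lambda>X. \<bar>L X\<bar>) + E (\<lambda>X. \<bar>D X\<bar>))"
    unfolding E_cmult E_add ..
  also have "\<dots> \<le> \<bar>t\<bar> / \<sigma> * (2 * sqrt (M * (\<Sum>x\<in>K. (\<xi> x)\<^sup>2)) + 3 * real (card J) * tau)"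
    unfolding L_def D_def using \<sigma>
    by (intro mult_left_mono add_mono E_abs_linear_le E_abs_diag_le) auto
  finally have 1: "cmod (E (\<lambda>X. iexp (t * (T X / \<sigma>))) - E (\<lambda>X. iexp (t * (W J X / \<sigma>))))
      \<le> \<bar>t\<bar> * ((2 * sqrt (M * (\<Sum>x\<in>K. (\<xi> x)\<^sup>2)) + 3 * real (card J) * tau) / \<sigma>)" by simp
  have 2: "cmod (x - z) \<le> cmod (x - y) + cmod (y - z)" for x y z
    using norm_triangle_ineq[of "x - y" "y - z"] by simp
  show ?thesis
    unfolding \<sigma>_def[symmetric]
    by (rule order_trans[OF 2 add_mono[OF 1 char_W_bound[OF tau beta, of t, folded \<sigma>_def]]])
qed

end

section \<open>The two-sample statistic\<close>

definition counts :: "'j set \<Rightarrow> ('j \<Rightarrow> 'x) \<Rightarrow> 'x \<Rightarrow> nat" where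
  "counts A X i = card {j \<in> A. X j = i}"

lemma counts_insert:
  assumes "finite A" "a \<notin> A"
  shows "counts (insert a A) (X(a := y)) = (counts A X)(y := Suc (counts A X y))"
proof
  fix i
  have "{j \<in> insert a A. (X(a := y)) j = i} = (if y = i then insert a {j \<in> A. X j = i} else {j \<in> A. X j = i})"
    using assms by auto
  then show "counts (insert a A) (X(a := y)) i = ((counts A X)(y := Suc (counts A X y))) i"
    using assms by (simp add: counts_def)
qed

lemma sum_counts:
  assumes "finite A" "finite K" "\<And>j. j \<in> A \<Longrightarrow> X j \<in> K"
  shows "(\<Sum>i\<in>K. counts A X i) = card A"
proof -
  have "(\<Sum>i\<in>K. card {j \<in> A. X j = i}) = (\<Sum>j\<in>A. card {i \<in> K. X j = i})"
    using sum.swap_restrict[OF assms(2,1), of "\<lambda>_ _. 1 :: nat" "\<lambda>i j. X j = i"] by simp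
  also have "\<dots> = (\<Sum>j\<in>A. 1)"
  proof (rule sum.cong[OF refl])
    fix j assume "j \<in> A"
    then have "{i \<in> K. X j = i} = {X j}" using assms(3) by auto
    then show "card {i \<in> K. X j = i} = 1" by simp
  qed
  finally show ?thesis by (simp add: counts_def)
qed

text \<open>The recursion of \<open>multinomial_pmf\<close> draws one more observation and
  increments its count, which by \<open>counts_insert\<close> is the effect of a new coordinate; the
  two draws only have to be commuted.\<close>

lemma multinomial_pmf_conv_Pi_pmf:
  assumes "finite A"
  shows "multinomial_pmf (card A) p = map_pmf (counts A) (Pi_pmf A d (\<lambda>_. p))"
  using assms
proof (induction A)
  case empty
  show ?case by (simp add: counts_def fun_eq_iff)
next
  case (insert a A)
  have "multinomial_pmf (card (insert a A)) p
      = bind_pmf (Pi_pmf A d (\<lambda>_. p)) (\<lambda>X. bind_pmf p (\<lambda>y. return_pmf ((counts A X)(y := Suc (counts A X y)))))"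
    using insert by (simp add: bind_map_pmf map_pmf_def[of _ p])
  also have "\<dots> = bind_pmf p (\<lambda>y. bind_pmf (Pi_pmf A d (\<lambda>_. p)) (\<lambda>X. return_pmf (counts (insert a A) (X(a := y)))))"
    unfolding counts_insert[OF insert.hyps] by (rule bind_commute_pmf)
  also have "\<dots> = map_pmf (counts (insert a A)) (Pi_pmf (insert a A) d (\<lambda>_. p))"
    using insert by (simp add: Pi_pmf_insert' map_bind_pmf)
  finally show ?case .
qed

text \<open>Puts the two independent samples on a single product space, as
  \<open>product_sample\<close> requires.\<close>

lemma pair_multinomial_pmf_conv_Pi_pmf:
  assumes "finite A" "finite B" "A \<inter> B = {}"
  shows "pair_pmf (multinomial_pmf (card A) p) (multinomial_pmf (card B) r)
    = map_pmf (\<lambda>X. (counts A X, counts B X)) (Pi_pmf (A \<union> B) d (\<lambda>j. if j \<in> A then p else r))"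
proof -
  let ?q = "\<lambda>j. if j \<in> A then p else r"
  have A: "Pi_pmf A d ?q = Pi_pmf A d (\<lambda>_. p)" by (intro Pi_pmf_cong) auto
  have B: "Pi_pmf B d ?q = Pi_pmf B d (\<lambda>_. r)" using assms by (intro Pi_pmf_cong) auto
  have cA: "counts A (\<lambda>j. if j \<in> A then X j else Y j) = counts A X" for X Y :: "'a \<Rightarrow> 'b"
    by (simp add: counts_def fun_eq_iff cong: conj_cong)
  have cB: "counts B (\<lambda>j. if j \<in> A then X j else Y j) = counts B Y" for X Y :: "'a \<Rightarrow> 'b"
  proof
    fix i
    have "{j \<in> B. (if j \<in> A then X j else Y j) = i} = {j \<in> B. Y j = i}"
      using assms(3) by auto
    then show "counts B (\<lambda>j. if j \<in> A then X j else Y j) i = counts B Y i"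
      by (simp only: counts_def)
  qed
  have "map_pmf (\<lambda>X. (counts A X, counts B X)) (Pi_pmf (A \<union> B) d ?q)
      = map_pmf (\<lambda>(X, Y). (counts A X, counts B Y)) (pair_pmf (Pi_pmf A d (\<lambda>_. p)) (Pi_pmf B d (\<lambda>_. r)))"
    unfolding Pi_pmf_union[OF assms] A B pmf.map_comp
    by (intro arg_cong2[of _ _ _ _ map_pmf] refl) (auto simp: fun_eq_iff cA cB)
  also have "\<dots> = pair_pmf (map_pmf (counts A) (Pi_pmf A d (\<lambda>_. p))) (map_pmf (counts B) (Pi_pmf B d (\<lambda>_. r)))"
    by (rule map_pair)
  finally show ?thesis
    using assms by (simp add: multinomial_pmf_conv_Pi_pmf[where d = d])
qed

section \<open>Specialisation to two samples\<close>

lemma sum_lessThan_add: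
  fixes f :: "nat \<Rightarrow> 'a::comm_monoid_add"
  shows "(\<Sum>j<n1 + n2. f j) = (\<Sum>j<n1. f j) + (\<Sum>j\<in>{n1..<n1 + n2}. f j)"
  by (subst sum.union_disjoint[symmetric]) (auto intro!: sum.cong)

lemma char_two_sample_bound:
  fixes n1 n2 k :: nat and P1 P2 :: "nat pmf" and m :: real
  defines "\<beta> \<equiv> 1 / real n1 + 1 / real n2"
    and "\<tau> \<equiv> \<Sum>i<k. (pmf P1 i / real n1 + pmf P2 i / real n2)\<^sup>2"
    and "\<xi> \<equiv> \<lambda>i. pmf P1 i - pmf P2 i"
  assumes n: "0 < n1" "0 < n2"
    and supp: "set_pmf P1 \<subseteq> {..<k}" "set_pmf P2 \<subseteq> {..<k}"
    and m: "\<And>i. i < k \<Longrightarrow> pmf P1 i \<le> m" "\<And>i. i < k \<Longrightarrow> pmf P2 i \<le> m"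
    and tau0: "0 < \<tau>"
  shows "cmod (measure_pmf.expectation (pair_pmf (multinomial_pmf n1 P1) (multinomial_pmf n2 P2))
        (\<lambda>(N1, N2). iexp (t * (((\<Sum>i<k. fstar n1 n2 (N1 i) (N2 i)) - sqnorm k \<xi>) / sqrt (2 * \<tau>))))
      - complex_of_real (exp (- (t\<^sup>2) / 2)))
    \<le> \<bar>t\<bar> * ((2 * sqrt (m * \<beta> * sqnorm k \<xi>) + 3 * real (n1 + n2) * \<tau>) / sqrt (2 * \<tau>))
      + \<bar>t\<bar> * (t\<^sup>2 * (9 / 2 * sqrt (4 * \<beta>\<^sup>2 * (\<beta>\<^sup>2 + 3 * (m * \<beta>)) / \<tau>))
        + \<bar>t\<bar> * (4 * sqrt (m * \<beta>) + \<beta> + 2 * m + sqrt ((8 * (m * \<beta>)\<^sup>2 + 4 * (m * \<beta>) * \<beta>\<^sup>2) / \<tau>)))"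
proof -
  define q where "q = (\<lambda>j. if j \<in> {..<n1} then P1 else P2)"
  define w where "w = (\<lambda>j. if j < n1 then 1 / real n1 else - (1 / real n2))"
  interpret product_sample "{..<n1 + n2}" q w "{..<k}"
    by unfold_locales (use supp in \<open>auto simp: q_def\<close>)
  have wpr: "wpr x = pmf P1 x / real n1 + pmf P2 x / real n2" for x
    unfolding wpr_def sum_lessThan_add using n
    by (simp add: q_def w_def power2_eq_square)
  have m0: "0 \<le> m" if "x < k" for x using m(1)[OF that] pmf_nonneg[of P1 x] by linarith
  \<comment> \<open>\<beta> is the sum of the two weight moduli, so it bounds each of them, and
    \<open>m * \<beta>\<close> bounds \<open>wpr\<close>.\<close>
  interpret bounded_product_sample "{..<n1 + n2}" q w "{..<k}" \<beta> m "m * \<beta>"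
  proof unfold_locales
    fix x assume x: "x \<in> {..<k}"
    show "wpr x \<le> m * \<beta>"
      unfolding wpr \<beta>_def using m x by (auto simp: distrib_left intro!: add_mono divide_right_mono)
    fix j
    show "\<bar>w j\<bar> * pmf (q j) x \<le> wpr x" unfolding wpr by (simp add: w_def q_def)
    show "pmf (q j) x \<le> m" using m x by (simp add: q_def)
  qed (simp add: w_def \<beta>_def)
  have tau: "tau = \<tau>" by (simp add: tau_def \<tau>_def wpr)
  have S: "\<xi> x + S {..<n1 + n2} x X
      = real (counts {..<n1} X x) / real n1 - real (counts {n1..<n1 + n2} X x) / real n2" for x X
  proof -
    have c: "(\<Sum>j\<in>A. of_bool (X j = x)) = real (counts A X x)" if "finite A" for A :: "nat set"
      using that by (simp add: counts_def sum.If_cases of_bool_def Int_def)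
    have "S {..<n1 + n2} x X = (\<Sum>j<n1. 1 / real n1 * (of_bool (X j = x) - pmf P1 x))
        + (\<Sum>j\<in>{n1..<n1 + n2}. - (1 / real n2) * (of_bool (X j = x) - pmf P2 x))"
      unfolding S_def sum_lessThan_add Z_def
      by (intro arg_cong2[of _ _ _ _ "(+)"] sum.cong) (auto simp: w_def q_def)
    also have "\<dots> = (real (counts {..<n1} X x) / real n1 - pmf P1 x)
        - (real (counts {n1..<n1 + n2} X x) / real n2 - pmf P2 x)"
      unfolding sum_distrib_left[symmetric] sum_subtractf c[OF finite_lessThan] c[OF finite_atLeastLessThan]
      using n by (simp add: field_simps)
    finally show ?thesis by (simp add: \<xi>_def)
  qed
  have w_sq: "(\<Sum>j<n1 + n2. (w j)\<^sup>2) = 1 / real n1 + 1 / real n2"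
    unfolding sum_lessThan_add using n by (simp add: w_def power2_eq_square)
  have P: "P = Pi_pmf ({..<n1} \<union> {n1..<n1 + n2}) undefined (\<lambda>j. if j \<in> {..<n1} then P1 else P2)"
    unfolding P_def by (intro Pi_pmf_cong) (auto simp: q_def)
  have pair: "pair_pmf (multinomial_pmf n1 P1) (multinomial_pmf n2 P2)
      = map_pmf (\<lambda>X. (counts {..<n1} X, counts {n1..<n1 + n2} X)) P"
  proof -
    have "{..<n1} \<inter> {n1..<n1 + n2} = {}" by auto
    then show ?thesis
      unfolding P using pair_multinomial_pmf_conv_Pi_pmf[of "{..<n1}" "{n1..<n1 + n2}" P1 P2 undefined]
      by simp
  qed
  \<comment> \<open>The counts of each sample add up to its size, so the linear corrections in
    \<open>fstar\<close> sum to the constant \<open>1 / n1 + 1 / n2\<close>, which is the sum of the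
    squared weights. This uses that all observations lie in \<open>{..<k}\<close>, as they do on the
    support of \<open>P\<close>.\<close>
  have stat: "(\<Sum>i<k. fstar n1 n2 (counts {..<n1} X i) (counts {n1..<n1 + n2} X i)) - sqnorm k \<xi>
      = (\<Sum>x<k. (\<xi> x + S {..<n1 + n2} x X)\<^sup>2) - (\<Sum>j<n1 + n2. (w j)\<^sup>2) - (\<Sum>x<k. (\<xi> x)\<^sup>2)"
    if X: "X \<in> set_pmf P" for X
  proof -
    have X: "X j < k" if "j < n1 + n2" for j using P_in_K[OF X, of j] that by simp
    have s: "(\<Sum>i<k. real (counts {..<n1} X i)) = real n1"
      "(\<Sum>i<k. real (counts {n1..<n1 + n2} X i)) = real n2"
      using sum_counts[of "{..<n1}" "{..<k}" X] sum_counts[of "{n1..<n1 + n2}" "{..<k}" X] X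
      by (simp_all flip: of_nat_sum)
    have "(\<Sum>i<k. fstar n1 n2 (counts {..<n1} X i) (counts {n1..<n1 + n2} X i))
        = (\<Sum>x<k. (\<xi> x + S {..<n1 + n2} x X)\<^sup>2)
          - (\<Sum>i<k. real (counts {..<n1} X i)) / (real n1)\<^sup>2 - (\<Sum>i<k. real (counts {n1..<n1 + n2} X i)) / (real n2)\<^sup>2"
      by (simp add: fstar_def S sum_subtractf sum_divide_distrib)
    then show ?thesis
      unfolding s w_sq sqnorm_def using n by (simp add: power2_eq_square)
  qed
  have "measure_pmf.expectation (pair_pmf (multinomial_pmf n1 P1) (multinomial_pmf n2 P2))
        (\<lambda>(N1, N2). iexp (t * (((\<Sum>i<k. fstar n1 n2 (N1 i) (N2 i)) - sqnorm k \<xi>) / sqrt (2 * \<tau>))))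
      = E (\<lambda>X. iexp (t * (((\<Sum>x<k. (\<xi> x + S {..<n1 + n2} x X)\<^sup>2) - (\<Sum>j<n1 + n2. (w j)\<^sup>2)
          - (\<Sum>x<k. (\<xi> x)\<^sup>2)) / sqrt (2 * tau))))"
    unfolding pair integral_map_pmf prod.case tau by (intro E_cong) (simp only: stat)
  moreover have "0 < \<beta>" using n by (simp add: \<beta>_def add_pos_pos)
  ultimately show ?thesis
    using char_statistic_bound[of t \<xi>] tau0 unfolding tau sqnorm_def by simp
qed

section \<open>Asymptotics\<close>

text \<open>With \<mu> the largest squared probability, the squared norm is at most
  \<open>sqrt \<mu>\<close> times the total mass 1. Squaring and dividing by the squared norm gives
  the first claim, so Condition 2 already forces the squared norms to 0.\<close>

lemma pmf_max_ratio:
  fixes p :: "nat pmf"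
  assumes k: "1 \<le> k" and supp: "set_pmf p \<subseteq> {..<k}"
  defines "r \<equiv> (MAX i\<in>{..<k}. (pmf p i)\<^sup>2) / sqnorm k (pmf p)"
  shows "sqnorm k (pmf p) \<le> r" and "i < k \<Longrightarrow> (pmf p i)\<^sup>2 \<le> r * sqnorm k (pmf p)"
proof -
  define v where "v = sqnorm k (pmf p)"
  define \<mu> where "\<mu> = (MAX i\<in>{..<k}. (pmf p i)\<^sup>2)"
  have sum1: "(\<Sum>i<k. pmf p i) = 1"
    using supp by (intro sum_pmf_eq_1) auto
  have \<mu>: "(pmf p i)\<^sup>2 \<le> \<mu>" if "i < k" for i
    unfolding \<mu>_def using that by (intro Max_ge) auto
  have "v \<noteq> 0"
  proof
    assume "v = 0"
    then have "\<forall>i<k. pmf p i = 0" by (simp add: v_def sqnorm_def sum_nonneg_eq_0_iff)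
    then show False using sum1 by simp
  qed
  moreover have "0 \<le> v" unfolding v_def sqnorm_def by (intro sum_nonneg) auto
  ultimately have v: "0 < v" by simp
  have "v \<le> (\<Sum>i<k. sqrt \<mu> * pmf p i)"
    unfolding v_def sqnorm_def power2_eq_square
    by (intro sum_mono mult_right_mono real_le_rsqrt \<mu>) auto
  also have "\<dots> = sqrt \<mu>" by (simp add: sum1 flip: sum_distrib_left)
  finally have "v\<^sup>2 \<le> \<mu>"
    using v by (metis less_imp_le order_less_le_trans real_sqrt_gt_0_iff real_sqrt_pow2_iff power_mono)
  then show "sqnorm k (pmf p) \<le> r"
    using v unfolding r_def v_def[symmetric] \<mu>_def[symmetric]
    by (simp add: pos_le_divide_eq power2_eq_square)
  show "(pmf p i)\<^sup>2 \<le> r * sqnorm k (pmf p)" if "i < k"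
    using v \<mu>[OF that] by (simp add: r_def flip: v_def \<mu>_def)
qed

text \<open>Here \<open>s\<close> and \<open>x\<close> stand for the squared norms of P_1 + P_2 and
  \<xi>. The lower bound on \<tau> turns \<open>1 / \<tau>\<close> into \<open>n^2 / s\<close>;
  powers of \<open>n\<close> are absorbed into \<open>n * \<beta>\<close>, a leftover
  \<open>1 / (n * s)\<close> by Condition 3, and a leftover \<open>1 / s\<close> by
  \<open>m^2 = \<delta> * s\<close>.\<close>

lemma error_term_bounds:
  fixes n s \<beta> \<tau> \<epsilon> \<delta> C x m :: real
  assumes n: "0 < n" and eps: "0 < \<epsilon>" "\<epsilon> \<le> n * s" and beta: "0 < \<beta>"
    and tau: "s / n\<^sup>2 \<le> \<tau>" "\<tau> \<le> \<beta>\<^sup>2 * s"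
    and delta: "0 \<le> \<delta>" and m: "m = sqrt (\<delta> * s)"
    and x: "0 \<le> x" "n\<^sup>2 * x\<^sup>2 \<le> C * s"
  shows "4 * \<beta>\<^sup>2 * (\<beta>\<^sup>2 + 3 * (m * \<beta>)) / \<tau> \<le> (4 * (n * \<beta>) ^ 4 / n + 12 * (n * \<beta>) ^ 3 * m) / \<epsilon>"
    and "(8 * (m * \<beta>)\<^sup>2 + 4 * (m * \<beta>) * \<beta>\<^sup>2) / \<tau> \<le> 8 * (n * \<beta>)\<^sup>2 * \<delta> + 4 * (n * \<beta>) ^ 3 * m / \<epsilon>"
    and "(2 * sqrt (m * \<beta> * x) + 3 * n * \<tau>) / sqrt (2 * \<tau>)
      \<le> 2 * sqrt (n * \<beta> * sqrt (\<delta> * C)) + 3 * (n * \<beta>) * sqrt s"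
proof -
  have s: "0 < s" using eps n by (metis less_le_trans zero_less_mult_pos)
  have m0: "0 \<le> m" using delta s by (simp add: m)
  have \<tau>: "0 < \<tau>" using tau(1) s n by (metis divide_pos_pos less_le_trans zero_less_power)
  have div: "y / \<tau> \<le> y * n\<^sup>2 / s" if "0 \<le> y" for y
  proof -
    have "y / \<tau> \<le> y / (s / n\<^sup>2)"
      using that \<tau> s n tau(1) by (intro divide_left_mono) auto
    then show ?thesis by simp
  qed
  have ns: "y / (n * s) \<le> y / \<epsilon>" if "0 \<le> y" for y
    using that eps n s by (intro divide_left_mono) auto
  have "4 * \<beta>\<^sup>2 * (\<beta>\<^sup>2 + 3 * (m * \<beta>)) / \<tau> \<le> 4 * \<beta>\<^sup>2 * (\<beta>\<^sup>2 + 3 * (m * \<beta>)) * n\<^sup>2 / s"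
    using m0 beta by (intro div) auto
  also have "\<dots> = (4 * (n * \<beta>) ^ 4 / n + 12 * (n * \<beta>) ^ 3 * m) / (n * s)"
    using n s by (simp add: field_simps eval_nat_numeral)
  also have "\<dots> \<le> (4 * (n * \<beta>) ^ 4 / n + 12 * (n * \<beta>) ^ 3 * m) / \<epsilon>"
    using n m0 beta by (intro ns) auto
  finally show "4 * \<beta>\<^sup>2 * (\<beta>\<^sup>2 + 3 * (m * \<beta>)) / \<tau> \<le> (4 * (n * \<beta>) ^ 4 / n + 12 * (n * \<beta>) ^ 3 * m) / \<epsilon>" .
  have m2: "m\<^sup>2 = \<delta> * s" using delta s by (simp add: m)
  have "(8 * (m * \<beta>)\<^sup>2 + 4 * (m * \<beta>) * \<beta>\<^sup>2) / \<tau> \<le> (8 * (m * \<beta>)\<^sup>2 + 4 * (m * \<beta>) * \<beta>\<^sup>2) * n\<^sup>2 / s"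
    using m0 beta by (intro div) auto
  also have "\<dots> = 8 * (n * \<beta>)\<^sup>2 * (m\<^sup>2 / s) + 4 * (n * \<beta>) ^ 3 * m / (n * s)"
    using n s by (simp add: field_simps eval_nat_numeral)
  also have "\<dots> \<le> 8 * (n * \<beta>)\<^sup>2 * \<delta> + 4 * (n * \<beta>) ^ 3 * m / \<epsilon>"
    using n m0 beta s by (intro add_mono ns) (auto simp: m2)
  finally show "(8 * (m * \<beta>)\<^sup>2 + 4 * (m * \<beta>) * \<beta>\<^sup>2) / \<tau> \<le> 8 * (n * \<beta>)\<^sup>2 * \<delta> + 4 * (n * \<beta>) ^ 3 * m / \<epsilon>" .
  have nx: "n * x \<le> sqrt (C * s)"
    using x n by (intro real_le_rsqrt) (simp add: power_mult_distrib)
  have C: "0 \<le> C"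
  proof -
    have "0 \<le> C * s" using x(2) by (meson order_trans zero_le_mult_iff zero_le_power2)
    then show ?thesis using s by (simp add: zero_le_mult_iff)
  qed
  have "sqrt (m * \<beta> * x) / sqrt (2 * \<tau>) \<le> sqrt (n * \<beta> * sqrt (\<delta> * C))"
  proof -
    have "m * \<beta> * x / (2 * \<tau>) \<le> m * \<beta> * x / \<tau>"
      using m0 beta x \<tau> by (intro divide_left_mono) auto
    also have "\<dots> \<le> m * \<beta> * x * n\<^sup>2 / s"
      using m0 beta x by (intro div) auto
    also have "\<dots> = n * \<beta> * (m * (n * x) / s)" by (simp add: power2_eq_square)
    \<comment> \<open>Condition 4 enters as \<open>n * x <= sqrt (C * s)\<close>; together with
      \<open>m = sqrt (\<delta> * s)\<close> the factor \<open>s\<close> cancels and a power of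
      \<delta> survives.\<close>
    also have "\<dots> \<le> n * \<beta> * (m * sqrt (C * s) / s)"
      using n beta m0 s nx by (intro mult_left_mono divide_right_mono) auto
    also have "m * sqrt (C * s) = sqrt (\<delta> * C) * s"
      using s by (simp add: m real_sqrt_mult)
    finally have "m * \<beta> * x / (2 * \<tau>) \<le> n * \<beta> * sqrt (\<delta> * C)" using s by simp
    then show ?thesis
      unfolding real_sqrt_divide[symmetric] by (rule real_sqrt_le_mono)
  qed
  moreover have "3 * n * \<tau> / sqrt (2 * \<tau>) \<le> 3 * (n * \<beta>) * sqrt s"
  proof -
    have "3 * n * \<tau> / sqrt (2 * \<tau>) \<le> 3 * n * \<tau> / sqrt \<tau>"
      using n \<tau> by (intro divide_left_mono) auto
    also have "\<dots> = 3 * n * sqrt \<tau>" using \<tau> by (simp add: real_div_sqrt flip: times_divide_eq_right)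
    also have "\<dots> \<le> 3 * n * sqrt (\<beta>\<^sup>2 * s)"
      using n tau(2) by (intro mult_left_mono) auto
    also have "\<dots> = 3 * (n * \<beta>) * sqrt s" using beta by (simp add: real_sqrt_mult)
    finally show ?thesis .
  qed
  ultimately show "(2 * sqrt (m * \<beta> * x) + 3 * n * \<tau>) / sqrt (2 * \<tau>)
      \<le> 2 * sqrt (n * \<beta> * sqrt (\<delta> * C)) + 3 * (n * \<beta>) * sqrt s"
    by (simp add: add_divide_distrib)
qed

text \<open>
  \<^term>\<open>measure_pmf p\<close> lives on the discrete sigma-algebra, so Levy's theorem is applied to its
  restriction to the Borel sets, which has the same distribution function.
\<close>
lemma weak_conv_m_measure_pmf:
  fixes p :: "nat \<Rightarrow> real pmf"
  assumes "real_distribution M"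
    and "\<And>t. (\<lambda>k. measure_pmf.expectation (p k) (\<lambda>x. iexp (t * x))) \<longlonglongrightarrow> char M t"
  shows "weak_conv_m (\<lambda>k. measure_pmf (p k)) M"
proof -
  define \<nu> where "\<nu> = (\<lambda>k. distr (measure_pmf (p k)) borel (\<lambda>x. x))"
  have "real_distribution (\<nu> k)" for k
    unfolding \<nu>_def by (intro prob_space.real_distribution_distr measure_pmf.prob_space_axioms) simp
  moreover have "char (\<nu> k) t = measure_pmf.expectation (p k) (\<lambda>x. iexp (t * x))" for k t
    unfolding char_def \<nu>_def by (subst integral_distr) auto
  ultimately have "weak_conv_m \<nu> M"
    using assms by (intro levy_continuity) simp_all
  moreover have "cdf (\<nu> k) = cdf (measure_pmf (p k))" for k
    by (simp add: cdf_def \<nu>_def measure_distr fun_eq_iff)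
  ultimately show ?thesis by (simp add: weak_conv_m_def)
qed

theorem theorem1:
  fixes n1 n2 :: "nat \<Rightarrow> nat"
    and P1 P2 :: "nat \<Rightarrow> nat pmf"
    and c :: real
  assumes supp1: "\<And>k. k \<ge> 1 \<Longrightarrow> set_pmf (P1 k) \<subseteq> {..<k}"
    and supp2: "\<And>k. k \<ge> 1 \<Longrightarrow> set_pmf (P2 k) \<subseteq> {..<k}"
    and cond1a: "filterlim (\<lambda>k. min (n1 k) (n2 k)) at_top sequentially"
    and cond1b: "(\<lambda>k. real (n1 k) / real (n1 k + n2 k)) \<longlonglongrightarrow> c"
    and c_pos: "0 < c" and c_lt1: "c < 1"
    and cond2a: "(\<lambda>k. (MAX i\<in>{..<k}. (pmf (P1 k) i)^2) / sqnorm k (pmf (P1 k))) \<longlonglongrightarrow> 0"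
    and cond2b: "(\<lambda>k. (MAX i\<in>{..<k}. (pmf (P2 k) i)^2) / sqnorm k (pmf (P2 k))) \<longlonglongrightarrow> 0"
    and cond3: "\<exists>\<epsilon>>0. \<forall>k\<ge>1.
        real (n1 k + n2 k) * sqnorm k (\<lambda>i. pmf (P1 k) i + pmf (P2 k) i) \<ge> \<epsilon>"
    and cond4: "(\<lambda>k. (real (n1 k + n2 k))^2 * (sqnorm k (\<lambda>i. pmf (P1 k) i - pmf (P2 k) i))^2)
        \<in> O[sequentially](\<lambda>k. sqnorm k (\<lambda>i. pmf (P1 k) i + pmf (P2 k) i))"
  shows "weak_conv_m
    (\<lambda>k. measure_pmf (map_pmf
       (\<lambda>(N1, N2). ((\<Sum>i<k. fstar (n1 k) (n2 k) (N1 i) (N2 i))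
                      - sqnorm k (\<lambda>i. pmf (P1 k) i - pmf (P2 k) i))
                    / sqrt (2 * (\<Sum>i<k. (pmf (P1 k) i / real (n1 k) + pmf (P2 k) i / real (n2 k))^2)))
       (pair_pmf (multinomial_pmf (n1 k) (P1 k)) (multinomial_pmf (n2 k) (P2 k)))))
    std_normal_distribution"
proof (rule weak_conv_m_measure_pmf[OF real_dist_normal_dist])
  fix t :: real
  define n where "n = (\<lambda>k. real (n1 k + n2 k))"
  define s where "s = (\<lambda>k. sqnorm k (\<lambda>i. pmf (P1 k) i + pmf (P2 k) i))"
  define x where "x = (\<lambda>k. sqnorm k (\<lambda>i. pmf (P1 k) i - pmf (P2 k) i))"
  define \<tau> where "\<tau> = (\<lambda>k. \<Sum>i<k. (pmf (P1 k) i / real (n1 k) + pmf (P2 k) i / real (n2 k))\<^sup>2)"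
  define r1 where "r1 = (\<lambda>k. (MAX i\<in>{..<k}. (pmf (P1 k) i)\<^sup>2) / sqnorm k (pmf (P1 k)))"
  define r2 where "r2 = (\<lambda>k. (MAX i\<in>{..<k}. (pmf (P2 k) i)\<^sup>2) / sqnorm k (pmf (P2 k)))"
  define \<delta> where "\<delta> = (\<lambda>k. r1 k + r2 k)"
  define m where "m = (\<lambda>k. sqrt (\<delta> k * s k))"
  define \<beta> where "\<beta> = (\<lambda>k. 1 / real (n1 k) + 1 / real (n2 k))"
  define \<phi> where "\<phi> = (\<lambda>k. measure_pmf.expectation
      (pair_pmf (multinomial_pmf (n1 k) (P1 k)) (multinomial_pmf (n2 k) (P2 k)))
      (\<lambda>(N1, N2). iexp (t * (((\<Sum>i<k. fstar (n1 k) (n2 k) (N1 i) (N2 i)) - x k) / sqrt (2 * \<tau> k)))))"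
  obtain \<epsilon> where eps: "0 < \<epsilon>" "\<And>k. 1 \<le> k \<Longrightarrow> \<epsilon> \<le> n k * s k"
    using cond3 by (auto simp: n_def s_def)
  obtain C where C: "\<forall>\<^sub>F k in sequentially. (n k)\<^sup>2 * (x k)\<^sup>2 \<le> C * s k"
  proof -
    have s0: "0 \<le> s k" for k unfolding s_def sqnorm_def by (intro sum_nonneg) auto
    from cond4 obtain C where "\<forall>\<^sub>F k in sequentially. norm ((n k)\<^sup>2 * (x k)\<^sup>2) \<le> C * norm (s k)"
      unfolding n_def s_def x_def by (elim landau_o.bigE)
    then show ?thesis using that[of C] s0 by simp
  qed
  \<comment> \<open>The bound of \<open>char_two_sample_bound\<close> after
    \<open>error_term_bounds\<close>. No quotient by \<tau> is left: \<open>n * \<beta>\<close>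
    converges, and \<open>1 / n\<close>, \<beta>, \<delta>, \<open>s\<close> and \<open>m\<close>
    tend to 0.\<close>
  define e where "e = (\<lambda>k. \<bar>t\<bar> * (2 * sqrt (n k * \<beta> k * sqrt (\<delta> k * C)) + 3 * (n k * \<beta> k) * sqrt (s k))
      + \<bar>t\<bar> * (t\<^sup>2 * (9 / 2 * sqrt ((4 * (n k * \<beta> k) ^ 4 / n k + 12 * (n k * \<beta> k) ^ 3 * m k) / \<epsilon>))
        + \<bar>t\<bar> * (4 * sqrt (m k * \<beta> k) + \<beta> k + 2 * m k
          + sqrt (8 * (n k * \<beta> k)\<^sup>2 * \<delta> k + 4 * (n k * \<beta> k) ^ 3 * m k / \<epsilon>))))"

  \<comment> \<open>The sample sizes are positive only eventually, and \<open>1 <= k\<close>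
    excludes the empty set of categories, for which the support hypotheses and Condition 3 say
    nothing.\<close>
  have pos: "\<forall>\<^sub>F k in sequentially. 1 \<le> k \<and> 0 < n1 k \<and> 0 < n2 k"
  proof -
    have "\<forall>\<^sub>F k in sequentially. 1 \<le> min (n1 k) (n2 k)"
      using cond1a by (simp add: filterlim_at_top)
    then show ?thesis using eventually_ge_at_top[of 1] by eventually_elim auto
  qed
  \<comment> \<open>\<delta> dominates both ratios of Condition 2 and \<open>s\<close> both squared
    norms, so \<open>\<delta> * s\<close> dominates every squared probability; hence the choice of
    \<open>m\<close>.\<close>
  have delta_s: "0 \<le> \<delta> k" "s k \<le> 2 * \<delta> k" "0 \<le> s k"
    "\<And>i. i < k \<Longrightarrow> pmf (P1 k) i \<le> m k" "\<And>i. i < k \<Longrightarrow> pmf (P2 k) i \<le> m k" if k: "1 \<le> k" for k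
  proof -
    let ?v1 = "sqnorm k (pmf (P1 k))" and ?v2 = "sqnorm k (pmf (P2 k))"
    note R1 = pmf_max_ratio[OF k supp1[OF k], folded r1_def] and R2 = pmf_max_ratio[OF k supp2[OF k], folded r2_def]
    have v0: "0 \<le> ?v1" "0 \<le> ?v2" unfolding sqnorm_def by (intro sum_nonneg; simp)+
    then have r0: "0 \<le> r1 k" "0 \<le> r2 k" using R1(1) R2(1) unfolding r1_def r2_def by linarith+
    then show "0 \<le> \<delta> k" by (simp add: \<delta>_def)
    have s_ge: "?v1 \<le> s k" "?v2 \<le> s k"
      unfolding s_def sqnorm_def by (intro sum_mono power_mono; simp)+
    then show "0 \<le> s k" using v0 by linarith
    have "s k \<le> (\<Sum>i<k. 2 * (pmf (P1 k) i)\<^sup>2 + 2 * (pmf (P2 k) i)\<^sup>2)"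
      unfolding s_def sqnorm_def
    proof (rule sum_mono)
      fix i
      show "(pmf (P1 k) i + pmf (P2 k) i)\<^sup>2 \<le> 2 * (pmf (P1 k) i)\<^sup>2 + 2 * (pmf (P2 k) i)\<^sup>2"
        using zero_le_power2[of "pmf (P1 k) i - pmf (P2 k) i"] by (simp add: power2_sum power2_diff)
    qed
    also have "\<dots> = 2 * (?v1 + ?v2)"
      by (simp add: sqnorm_def sum.distrib sum_distrib_left)
    finally show "s k \<le> 2 * \<delta> k" using R1(1) R2(1) by (simp add: \<delta>_def r1_def r2_def)
    fix i assume i: "i < k"
    have "(pmf (P1 k) i)\<^sup>2 \<le> r1 k * ?v1" using R1(2)[OF i] by (simp add: r1_def)
    also have "\<dots> \<le> \<delta> k * s k" using r0 s_ge v0 by (intro mult_mono) (auto simp: \<delta>_def)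
    finally show "pmf (P1 k) i \<le> m k" unfolding m_def by (rule real_le_rsqrt)
    have "(pmf (P2 k) i)\<^sup>2 \<le> r2 k * ?v2" using R2(2)[OF i] by (simp add: r2_def)
    also have "\<dots> \<le> \<delta> k * s k" using r0 s_ge v0 by (intro mult_mono) (auto simp: \<delta>_def)
    finally show "pmf (P2 k) i \<le> m k" unfolding m_def by (rule real_le_rsqrt)
  qed
  have bound: "\<forall>\<^sub>F k in sequentially. cmod (\<phi> k - complex_of_real (exp (- (t\<^sup>2) / 2))) \<le> e k"
    using pos C
  proof eventually_elim
    case (elim k)
    then have k: "1 \<le> k" and n12: "0 < n1 k" "0 < n2 k" by auto
    have n0: "0 < n k" using n12 by (simp add: n_def)
    have b0: "0 < \<beta> k" using n12 by (simp add: \<beta>_def add_pos_pos)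
    \<comment> \<open>\<tau> is compared with \<open>s\<close> from below and above: the reciprocal
      of either sample size lies between \<open>1 / n\<close> and \<beta>.\<close>
    have tau1: "s k / (n k)\<^sup>2 \<le> \<tau> k"
      unfolding s_def sqnorm_def \<tau>_def sum_divide_distrib power_divide[symmetric]
    proof (intro sum_mono power_mono)
      fix i
      show "(pmf (P1 k) i + pmf (P2 k) i) / n k \<le> pmf (P1 k) i / real (n1 k) + pmf (P2 k) i / real (n2 k)"
        unfolding add_divide_distrib using n12
        by (intro add_mono divide_left_mono) (auto simp: n_def)
      show "0 \<le> (pmf (P1 k) i + pmf (P2 k) i) / n k" using n0 by simp
    qed
    have tau2: "\<tau> k \<le> (\<beta> k)\<^sup>2 * s k"
      unfolding s_def sqnorm_def \<tau>_def sum_distrib_left power_mult_distrib[symmetric]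
    proof (intro sum_mono power_mono)
      fix i
      show "pmf (P1 k) i / real (n1 k) + pmf (P2 k) i / real (n2 k) \<le> \<beta> k * (pmf (P1 k) i + pmf (P2 k) i)"
        by (simp add: \<beta>_def distrib_left distrib_right)
    qed auto
    have s0: "0 < s k" using eps(1) eps(2)[OF k] n0 by (metis less_le_trans zero_less_mult_pos)
    have tau0: "0 < \<tau> k" using tau1 s0 n0 by (metis divide_pos_pos less_le_trans zero_less_power)
    have x0: "0 \<le> x k" unfolding x_def sqnorm_def by (intro sum_nonneg) auto
    note b = error_term_bounds[OF n0 eps(1) eps(2)[OF k] b0 tau1 tau2 delta_s(1)[OF k] m_def[THEN fun_cong] x0 elim(2)]
    have "cmod (\<phi> k - complex_of_real (exp (- (t\<^sup>2) / 2)))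
      \<le> \<bar>t\<bar> * ((2 * sqrt (m k * \<beta> k * x k) + 3 * n k * \<tau> k) / sqrt (2 * \<tau> k))
      + \<bar>t\<bar> * (t\<^sup>2 * (9 / 2 * sqrt (4 * (\<beta> k)\<^sup>2 * ((\<beta> k)\<^sup>2 + 3 * (m k * \<beta> k)) / \<tau> k))
        + \<bar>t\<bar> * (4 * sqrt (m k * \<beta> k) + \<beta> k + 2 * m k
          + sqrt ((8 * (m k * \<beta> k)\<^sup>2 + 4 * (m k * \<beta> k) * (\<beta> k)\<^sup>2) / \<tau> k)))"
      using char_two_sample_bound[OF n12 supp1[OF k] supp2[OF k] delta_s(4,5)[OF k] tau0[unfolded \<tau>_def], of t]
      by (simp only: \<phi>_def \<tau>_def x_def n_def \<beta>_def)
    also have "\<dots> \<le> e k"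
      unfolding e_def
      by (intro add_mono mult_left_mono b real_sqrt_le_mono order_refl) auto
    finally show ?case .
  qed

  have min_top: "filterlim (\<lambda>k. real (min (n1 k) (n2 k))) at_top sequentially"
    by (rule filterlim_compose[OF filterlim_real_sequentially cond1a])
  have inv0: "(\<lambda>k. 1 / f k) \<longlonglongrightarrow> 0" if "\<And>k. real (min (n1 k) (n2 k)) \<le> f k" for f :: "nat \<Rightarrow> real"
  proof -
    have "filterlim f at_top sequentially"
      using that by (intro filterlim_at_top_mono[OF min_top]) auto
    then show ?thesis using tendsto_inverse_0_at_top by (simp add: field_simps)
  qed
  have lim_n: "(\<lambda>k. 1 / n k) \<longlonglongrightarrow> 0" by (rule inv0) (simp add: n_def)
  have lim_beta: "\<beta> \<longlonglongrightarrow> 0"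
    unfolding \<beta>_def by (intro tendsto_add_zero inv0) auto
  \<comment> \<open>With \<open>r = n1 / n\<close> the product \<open>n * \<beta>\<close> equals
    \<open>1 / r + 1 / (1 - r)\<close>; here \<open>c\<close> has to differ from 0 and 1.\<close>
  have lim_B: "(\<lambda>k. n k * \<beta> k) \<longlonglongrightarrow> 1 / c + 1 / (1 - c)"
  proof (rule Lim_transform_eventually)
    let ?r = "\<lambda>k. real (n1 k) / real (n1 k + n2 k)"
    show "(\<lambda>k. 1 / ?r k + 1 / (1 - ?r k)) \<longlonglongrightarrow> 1 / c + 1 / (1 - c)"
      using c_pos c_lt1 by (intro tendsto_intros cond1b) auto
    show "\<forall>\<^sub>F k in sequentially. 1 / ?r k + 1 / (1 - ?r k) = n k * \<beta> k"
      using pos by eventually_elim (simp add: n_def \<beta>_def field_simps)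
  qed
  have lim_delta: "\<delta> \<longlonglongrightarrow> 0"
    unfolding \<delta>_def r1_def r2_def by (rule tendsto_add_zero[OF cond2a cond2b])
  have lim_s: "s \<longlonglongrightarrow> 0"
  proof (rule tendsto_sandwich[of "\<lambda>_. 0" s _ "\<lambda>k. 2 * \<delta> k"])
    show "\<forall>\<^sub>F k in sequentially. 0 \<le> s k" "\<forall>\<^sub>F k in sequentially. s k \<le> 2 * \<delta> k"
      using eventually_ge_at_top[of 1] by (eventually_elim, use delta_s in auto)+
    show "(\<lambda>k. 2 * \<delta> k) \<longlonglongrightarrow> 0" using tendsto_mult_left[OF lim_delta, of 2] by simp
  qed simp
  have lim_m: "m \<longlonglongrightarrow> 0"
    unfolding m_def using tendsto_real_sqrt[OF tendsto_mult[OF lim_delta lim_s]] by simp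
  have lim_e: "e \<longlonglongrightarrow> 0"
  proof -
    let ?b = "1 / c + 1 / (1 - c)"
    \<comment> \<open>This is \<open>e\<close> with division by \<open>n k\<close> written as a
      factor \<open>1 / n k\<close>, since it is this reciprocal that has a finite limit.\<close>
    have "(\<lambda>k. \<bar>t\<bar> * (2 * sqrt (n k * \<beta> k * sqrt (\<delta> k * C)) + 3 * (n k * \<beta> k) * sqrt (s k))
      + \<bar>t\<bar> * (t\<^sup>2 * (9 / 2 * sqrt ((4 * (n k * \<beta> k) ^ 4 * (1 / n k) + 12 * (n k * \<beta> k) ^ 3 * m k) / \<epsilon>))
        + \<bar>t\<bar> * (4 * sqrt (m k * \<beta> k) + \<beta> k + 2 * m k
          + sqrt (8 * (n k * \<beta> k)\<^sup>2 * \<delta> k + 4 * (n k * \<beta> k) ^ 3 * m k / \<epsilon>))))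
      \<longlonglongrightarrow> \<bar>t\<bar> * (2 * sqrt (?b * sqrt (0 * C)) + 3 * ?b * sqrt 0)
      + \<bar>t\<bar> * (t\<^sup>2 * (9 / 2 * sqrt ((4 * ?b ^ 4 * 0 + 12 * ?b ^ 3 * 0) / \<epsilon>))
        + \<bar>t\<bar> * (4 * sqrt (0 * 0) + 0 + 2 * 0
          + sqrt (8 * ?b\<^sup>2 * 0 + 4 * ?b ^ 3 * 0 / \<epsilon>)))"
      using eps(1) by (intro tendsto_intros lim_n lim_beta lim_B lim_delta lim_s lim_m) auto
    then show ?thesis by (simp add: e_def)
  qed
  have "\<phi> \<longlonglongrightarrow> complex_of_real (exp (- (t\<^sup>2) / 2))"
    by (rule LIM_zero_cancel[OF Lim_null_comparison[OF bound lim_e]])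
  then show "(\<lambda>k. measure_pmf.expectation (map_pmf
       (\<lambda>(N1, N2). ((\<Sum>i<k. fstar (n1 k) (n2 k) (N1 i) (N2 i))
                      - sqnorm k (\<lambda>i. pmf (P1 k) i - pmf (P2 k) i))
                    / sqrt (2 * (\<Sum>i<k. (pmf (P1 k) i / real (n1 k) + pmf (P2 k) i / real (n2 k))^2)))
       (pair_pmf (multinomial_pmf (n1 k) (P1 k)) (multinomial_pmf (n2 k) (P2 k))))
       (\<lambda>x. iexp (t * x))) \<longlonglongrightarrow> char std_normal_distribution t"
    unfolding integral_map_pmf char_std_normal_distribution \<phi>_def x_def \<tau>_def
    by (simp only: case_prod_beta')
qed

end
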